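(* Every Lie bialgebra structure $(\overline{\mathfrak L},[\cdot,\cdot],\Delta)$ on $\overline{\mathfrak L}$ is triangular coboundary. That is, there exists $r\in\mathrm{Im}(1-\tau)\subset\overline{\mathfrak L}\otimes\overline{\mathfrak L}$ such that $\Delta(x)=x\cdot r$ for all $x\in\overline{\mathfrak L}$ and $c(r)=0$.
   Context: Let $\mathbb F$ be a field of characteristic $0$ and let $\Gamma$ be an additive subgroup of $\mathbb F$ with $\mathbb Z\subseteq\Gamma$. The centerless generalized Heisenberg–Virasoro algebra $\overline{\mathfrak L}$ is the Lie algebra with basis $\{L_x:x\in\Gamma\}\cup\{I_x:x\in\Gamma\setminus\{0\}\}$ (with the convention $I_0=0$) and brackets $[L_x,L_y]=(y-x)L_{x+y}$, $[L_x,I_y]=yI_{x+y}$, $[I_x,I_y]=0$. The action on tensor powers is the diagonal adjoint action, e.g. $x\cdot(a\otimes b)=[x,a]\otimes b+a\otimes[x,b]$. Define $\tau(a\otimes b)=b\otimes a$ and $\xi(a\otimes b\otimes c)=b\otimes c\otimes a$. A Lie bialgebra structure is a linear map $\Delta:\overline{\mathfrak L}\to\overline{\mathfrak L}\otimes\overline{\mathfrak L}$ such that: - $\mathrm{Im}\,\Delta\subseteq\mathrm{Im}(1-\tau)$; - $(1+\xi+\xi^2)(1\otimes\Delta)\Delta=0$; - $\Delta([x,y])=x\cdot\Delta(y)-y\cdot\Delta(x)$. For $r=\sum_i a_i\otimes b_i$, $c(r)=\sum_{i,j}\big([a_i,a_j]\otimes b_i\otimes b_j+a_i\otimes[b_i,a_j]\otimes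 b_j+a_i\otimes a_j\otimes[b_i,b_j]\big)$. *)

theory Defs
  imports Main
begin

text \<open>Basis indices of the centerless generalized Heisenberg-Virasoro algebra:
  Lb x stands for L_x and Ib x for I_x.  Elements of the algebra are finitely
  supported coefficient functions on the basis; tensor squares/cubes are finitely
  supported coefficient functions on pairs/triples of basis indices.\<close>

datatype 'a hvb = Lb 'a | Ib 'a

definition hsupp :: "('b \<Rightarrow> 'a::zero) \<Rightarrow> 'b set" where
  "hsupp f = {x. f x \<noteq> 0}"

definition hv_basis :: "'a::zero set \<Rightarrow> 'a hvb set" where
  "hv_basis \<Gamma> = Lb ` \<Gamma> \<union> Ib ` (\<Gamma> - {0})"

definition hv_carrier :: "'a::field set \<Rightarrow> ('a hvb \<Rightarrow> 'a) set" where
  "hv_carrier \<Gamma> = {v. finite (hsupp v) \<and> hsupp v \<subseteq> hv_basis \<Gamma>}"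

definition hv_carrier2 :: "'a::field set \<Rightarrow> ('a hvb \<times> 'a hvb \<Rightarrow> 'a) set" where
  "hv_carrier2 \<Gamma> = {t. finite (hsupp t) \<and> hsupp t \<subseteq> hv_basis \<Gamma> \<times> hv_basis \<Gamma>}"

definition delta :: "'b \<Rightarrow> 'b \<Rightarrow> 'a::zero_neq_one" where
  "delta b = (\<lambda>c. if c = b then 1 else 0)"

text \<open>Bracket of two basis vectors, as a coefficient function (with I_0 = 0).\<close>
fun hv_br_basis :: "'a::field hvb \<Rightarrow> 'a hvb \<Rightarrow> 'a hvb \<Rightarrow> 'a" where
  "hv_br_basis (Lb x) (Lb y) = (\<lambda>c. (y - x) * delta (Lb (x + y)) c)"
| "hv_br_basis (Lb x) (Ib y) = (\<lambda>c. if x + y = 0 then 0 else y * delta (Ib (x + y)) c)"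
| "hv_br_basis (Ib y) (Lb x) = (\<lambda>c. if x + y = 0 then 0 else - (y * delta (Ib (x + y)) c))"
| "hv_br_basis (Ib x) (Ib y) = (\<lambda>c. 0)"

definition hv_bracket :: "('a::field hvb \<Rightarrow> 'a) \<Rightarrow> ('a hvb \<Rightarrow> 'a) \<Rightarrow> 'a hvb \<Rightarrow> 'a" where
  "hv_bracket v w = (\<lambda>c. \<Sum>b\<in>hsupp v. \<Sum>b'\<in>hsupp w. v b * w b' * hv_br_basis b b' c)"

definition hv_act2 :: "('a::field hvb \<Rightarrow> 'a) \<Rightarrow> ('a hvb \<times> 'a hvb \<Rightarrow> 'a) \<Rightarrow> 'a hvb \<times> 'a hvb \<Rightarrow> 'a" where
  "hv_act2 x t = (\<lambda>(c1, c2). \<Sum>p\<in>hsupp t. t p *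
      (hv_bracket x (delta (fst p)) c1 * delta (snd p) c2
       + delta (fst p) c1 * hv_bracket x (delta (snd p)) c2))"

definition hv_tau :: "('b \<times> 'b \<Rightarrow> 'a) \<Rightarrow> 'b \<times> 'b \<Rightarrow> 'a" where
  "hv_tau t = (\<lambda>(c1, c2). t (c2, c1))"

text \<open>xi (a \<otimes> b \<otimes> c) = b \<otimes> c \<otimes> a, on coefficient functions.\<close>
definition hv_xi :: "('b \<times> 'b \<times> 'b \<Rightarrow> 'a) \<Rightarrow> 'b \<times> 'b \<times> 'b \<Rightarrow> 'a" where
  "hv_xi t = (\<lambda>(c1, c2, c3). t (c3, c1, c2))"

definition hv_im_1_tau :: "'a::field set \<Rightarrow> ('a hvb \<times> 'a hvb \<Rightarrow> 'a) set" where
  "hv_im_1_tau \<Gamma> = {(\<lambda>p. s p - hv_tau s p) | s. s \<in> hv_carrier2 \<Gamma>}"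

definition hv_one_tensor ::
  "(('a::field hvb \<Rightarrow> 'a) \<Rightarrow> 'a hvb \<times> 'a hvb \<Rightarrow> 'a) \<Rightarrow> ('a hvb \<times> 'a hvb \<Rightarrow> 'a)
     \<Rightarrow> 'a hvb \<times> 'a hvb \<times> 'a hvb \<Rightarrow> 'a" where
  "hv_one_tensor D t = (\<lambda>(c1, c2, c3). \<Sum>p\<in>hsupp t. t p * delta (fst p) c1 * D (delta (snd p)) (c2, c3))"

definition is_lie_bialgebra ::
  "'a::field set \<Rightarrow> (('a hvb \<Rightarrow> 'a) \<Rightarrow> 'a hvb \<times> 'a hvb \<Rightarrow> 'a) \<Rightarrow> bool" where
  "is_lie_bialgebra \<Gamma> D \<longleftrightarrow>
     (\<forall>u\<in>hv_carrier \<Gamma>. D u \<in> hv_carrier2 \<Gamma>) \<and>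
     (\<forall>u\<in>hv_carrier \<Gamma>. \<forall>v\<in>hv_carrier \<Gamma>. D (\<lambda>b. u b + v b) = (\<lambda>p. D u p + D v p)) \<and>
     (\<forall>a. \<forall>u\<in>hv_carrier \<Gamma>. D (\<lambda>b. a * u b) = (\<lambda>p. a * D u p)) \<and>
     (\<forall>u\<in>hv_carrier \<Gamma>. D u \<in> hv_im_1_tau \<Gamma>) \<and>
     (\<forall>u\<in>hv_carrier \<Gamma>.
        (let w = hv_one_tensor D (D u) in (\<lambda>q. w q + hv_xi w q + hv_xi (hv_xi w) q) = (\<lambda>q. 0))) \<and>
     (\<forall>u\<in>hv_carrier \<Gamma>. \<forall>v\<in>hv_carrier \<Gamma>.
        D (hv_bracket u v) = (\<lambda>p. hv_act2 u (D v) p - hv_act2 v (D u) p))"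

definition hv_cyb :: "('a::field hvb \<times> 'a hvb \<Rightarrow> 'a) \<Rightarrow> 'a hvb \<times> 'a hvb \<times> 'a hvb \<Rightarrow> 'a" where
  "hv_cyb r = (\<lambda>(c1, c2, c3). \<Sum>i\<in>hsupp r. \<Sum>j\<in>hsupp r. r i * r j *
      (hv_bracket (delta (fst i)) (delta (fst j)) c1 * delta (snd i) c2 * delta (snd j) c3
       + delta (fst i) c1 * hv_bracket (delta (snd i)) (delta (fst j)) c2 * delta (snd j) c3
       + delta (fst i) c1 * delta (fst j) c2 * hv_bracket (delta (snd i)) (delta (snd j)) c3))"

end

theory Submission
  imports Defs
begin

text \<open>
  After subtracting a coboundary, \<open>\<Delta>\<close> preserves degrees. Comparing coefficients then turns the cocycle condition
  on the \<open>L\<^sub>x\<close> into three functional equations over \<open>\<Gamma>\<close>, one each for the \<open>L \<otimes> L\<close>, \<open>L \<otimes> I\<close> and \<open>I \<otimes> I\<close>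
  components. They have explicit solutions: the coefficients of a degree-zero tensor \<open>r\<close> are read off from
  those of \<open>L\<^sub>0 \<otimes> L\<^sub>x\<close> and \<open>L\<^sub>0 \<otimes> I\<^sub>x\<close> in \<open>\<Delta>(L\<^sub>x)\<close> and of \<open>I\<^sub>1 \<otimes> I\<^sub>q\<close> in \<open>\<Delta>(L\<^bsub>1+q\<^esub>)\<close>. A priori this \<open>r\<close> is an infinite
  sum; its finiteness comes from the finite support of each \<open>\<Delta>(L\<^sub>x)\<close>, by arguments valid for all but finitely
  many elements of \<open>\<Gamma>\<close>. Skew-symmetry is essential in the \<open>I \<otimes> I\<close> component: for \<open>\<Gamma> = \<int>\<close> the symmetric infinite
  tensor with coefficients \<open>sgn(x)/x\<close> at \<open>I\<^sub>x \<otimes> I\<^bsub>-x\<^esub>\<close> induces an outer derivation.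
  Once \<open>\<Delta>\<close> vanishes on all \<open>L\<^sub>x\<close>, it vanishes on all \<open>I\<^sub>y\<close> as well. Finally the co-Jacobi identity says that
  \<open>c(r)\<close> is invariant under all \<open>L\<^sub>n\<close>, and a finitely supported invariant tensor is zero since \<open>L\<^sub>n\<close> with \<open>n\<close> generic
  moves its support off itself.
\<close>

section \<open>Subgroups containing the integers\<close>

locale int_subgroup =
  fixes \<Gamma> :: "'a::field_char_0 set"
  assumes zero_mem [simp]: "0 \<in> \<Gamma>"
    and add_mem [simp]: "\<And>x y. x \<in> \<Gamma> \<Longrightarrow> y \<in> \<Gamma> \<Longrightarrow> x + y \<in> \<Gamma>"
    and minus_mem [simp]: "\<And>x. x \<in> \<Gamma> \<Longrightarrow> - x \<in> \<Gamma>"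
    and Ints_sub: "\<int> \<subseteq> \<Gamma>"
begin

lemma diff_mem [simp]: "x \<in> \<Gamma> \<Longrightarrow> y \<in> \<Gamma> \<Longrightarrow> x - y \<in> \<Gamma>"
  using add_mem[of x "- y"] by simp

lemma of_nat_mem [simp]: "of_nat n \<in> \<Gamma>"
  using Ints_sub by auto

lemma numeral_mem [simp]: "numeral n \<in> \<Gamma>" "1 \<in> \<Gamma>"
  using Ints_sub by auto

lemma of_nat_mult_mem [simp]: "x \<in> \<Gamma> \<Longrightarrow> of_nat n * x \<in> \<Gamma>"
  by (induction n) (auto simp: algebra_simps)

lemma of_int_mult_mem [simp]: "x \<in> \<Gamma> \<Longrightarrow> of_int n * x \<in> \<Gamma>"
  using of_nat_mult_mem[of x] by (cases n rule: int_cases2) auto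

lemma numeral_mult_mem [simp]: "x \<in> \<Gamma> \<Longrightarrow> numeral n * x \<in> \<Gamma>"
  using of_nat_mult_mem[of x "numeral n"] by simp

lemma infinite_subgroup: "infinite \<Gamma>"
proof
  assume "finite \<Gamma>"
  then have "finite (range (of_int :: int \<Rightarrow> 'a))"
    using Ints_sub finite_subset by (auto simp: Ints_def)
  then show False
    using finite_imageD[of "of_int :: int \<Rightarrow> 'a" UNIV] infinite_UNIV_int by (auto simp: inj_def)
qed

text \<open>This filter expresses "for generic \<open>z\<close> in \<Gamma>": finite supports make
  unwanted terms vanish off a finite set, and \<open>eventually_elim\<close> combines finitely many
  such exceptions.\<close>

definition almost_all :: "'a filter" where
  "almost_all = inf cofinite (principal \<Gamma>)"

lemma eventually_almost_all: "eventually P almost_all \<longleftrightarrow> finite {z \<in> \<Gamma>. \<not> P z}"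
  unfolding almost_all_def eventually_inf_principal eventually_cofinite
  by (rule arg_cong[where f = finite]) auto

lemma almost_all_mem: "\<forall>\<^sub>F z in almost_all. z \<in> \<Gamma>"
  unfolding eventually_almost_all by auto

lemma almost_all_neq: "\<forall>\<^sub>F z in almost_all. z \<noteq> c"
  unfolding eventually_almost_all by auto

lemma almost_all_neq_mult: "k \<noteq> 0 \<Longrightarrow> \<forall>\<^sub>F z in almost_all. k * z \<noteq> c"
  using almost_all_neq[of "c / k"] by eventually_elim auto

text \<open>This closes the genericity arguments: a claim not mentioning the auxiliary element holds
  outright once it is proved for generic choices, because \<Gamma> is infinite.\<close>

lemma almost_all_const: "eventually (\<lambda>z. P) almost_all \<longleftrightarrow> P"
  using infinite_subgroup unfolding eventually_almost_all by (cases P) auto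

lemma almost_all_shift:
  assumes "y \<in> \<Gamma>" "eventually P almost_all"
  shows "\<forall>\<^sub>F z in almost_all. P (z + y)"
proof -
  have "{z \<in> \<Gamma>. \<not> P (z + y)} \<subseteq> (\<lambda>z. z - y) ` {z \<in> \<Gamma>. \<not> P z}"
  proof
    fix z assume "z \<in> {z \<in> \<Gamma>. \<not> P (z + y)}"
    then show "z \<in> (\<lambda>z. z - y) ` {z \<in> \<Gamma>. \<not> P z}"
      using assms(1) by (intro image_eqI[of _ _ "z + y"]) auto
  qed
  then show ?thesis
    using assms(2) finite_surj unfolding eventually_almost_all by blast
qed

lemma almost_all_reflect:
  assumes "y \<in> \<Gamma>" "eventually P almost_all"
  shows "\<forall>\<^sub>F z in almost_all. P (y - z)"
proof -
  have "{z \<in> \<Gamma>. \<not> P (y - z)} \<subseteq> (\<lambda>z. y - z) ` {z \<in> \<Gamma>. \<not> P z}"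
  proof
    fix z assume "z \<in> {z \<in> \<Gamma>. \<not> P (y - z)}"
    then show "z \<in> (\<lambda>z. y - z) ` {z \<in> \<Gamma>. \<not> P z}"
      using assms(1) by (intro image_eqI[of _ _ "y - z"]) auto
  qed
  then show ?thesis
    using assms(2) finite_surj unfolding eventually_almost_all by blast
qed

end

text \<open>The nine instances used below come from a search by linear algebra; no bound on the support of \<open>g\<close> is involved.\<close>

lemma witt_cocycle_multiples:
  fixes g :: "int \<Rightarrow> int \<Rightarrow> 'a::field_char_0"
  assumes skew: "\<And>i j. g j i = - g i j"
    and deg0: "\<And>i. g i (- i) = 0"
    and eq: "\<And>i j k. of_int (i + j - 2 * k) * g i j =
        of_int (i - 2 * k) * g (i - k) j + of_int (j - 2 * k) * g i (j - k)
      + of_int (i + 2 * j - 2 * k) * g (k - j) j + of_int (2 * i + j - 2 * k) * g i (k - i)"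
  shows "g 0 1 = g 0 (- 1)"
proof -
  have diag: "g i i = 0" for i
    using skew[of i i] by simp
  have z: "g i j = 0" if "i + j = 0" for i j
    using deg0[of i] that by (simp add: add_eq_0_iff)
  have sk: "g 0 (- 1) = - g (- 1) 0" "g 0 (- 2) = - g (- 2) 0" "g 0 (- 3) = - g (- 3) 0"
    "g 1 0 = - g 0 1" "g 2 0 = - g 0 2" "g 3 0 = - g 0 3" "g (- 1) (- 2) = - g (- 2) (- 1)"
    "g (- 1) (- 3) = - g (- 3) (- 1)"
    "g 1 (- 2) = - g (- 2) 1" "g 1 (- 3) = - g (- 3) 1" "g 2 (- 1) = - g (- 1) 2" "g 2 (- 3) = - g (- 3) 2"
    "g 3 (- 1) = - g (- 1) 3" "g 3 (- 2) = - g (- 2) 3"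
    by (rule skew)+
  note z = diag z
  have e1: "3 * g (- 1) 2 + (- 1) * g 0 2 + (- 4) * g (- 1) 3 + (- 5) * g (- 3) 2 + (- 2) * g (- 1) 0 = 0"
    using eq[of "-1" "2" "-1"] by (simp add: sk z algebra_simps)
  have e2: "5 * g (- 1) 0 + 5 * g 0 2 + (- 6) * g (- 1) 3 + (- 5) * g (- 3) 0 + 4 * g (- 2) (- 1) = 0"
    using eq[of "-1" "0" "-3"] by (simp add: sk z algebra_simps)
  have e3: "3 * g (- 2) 1 + (- 2) * g 0 1 + (- 5) * g (- 2) 3 + (- 4) * g (- 3) 1 + (- 1) * g (- 2) 0 = 0"
    using eq[of "-2" "1" "-2"] by (simp add: sk z algebra_simps)
  have e4: "4 * g (- 2) 0 + 4 * g 0 1 + (- 6) * g (- 2) 3 + (- 4) * g (- 3) 0 + (- 2) * g (- 2) (- 1) = 0"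
    using eq[of "-2" "0" "-3"] by (simp add: sk z algebra_simps)
  have e5: "1 * g (- 3) 0 + (- 1) * g (- 1) 0 + (- 4) * g (- 3) 2 + (- 1) * g (- 2) 0 + 2 * g (- 3) 1 = 0"
    using eq[of "-3" "0" "-2"] by (simp add: sk z algebra_simps)
  have e6: "3 * g (- 1) 0 + 3 * g 0 1 + (- 4) * g (- 1) 2 + (- 3) * g (- 2) 0 = 0"
    using eq[of "-1" "0" "-2"] by (simp add: sk z algebra_simps)
  have e7: "1 * g (- 2) (- 1) + 2 * g (- 1) 0 + (- 3) * g (- 2) 1 + 1 * g (- 2) 0 = 0"
    using eq[of "-2" "-1" "-2"] by (simp add: sk z algebra_simps)
  have e8: "5 * g (- 1) 3 + 5 * g (- 3) 1 = 0"
    using eq[of "-1" "1" "-2"] by (simp add: sk z algebra_simps)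
  have e9: "g 0 1 + 3 * g (- 1) 2 + 3 * g (- 2) 1 + g (- 1) 0 = 0"
    using eq[of "-1" "1" "-1"] by (simp add: sk z algebra_simps)
  have "3920 * (g 0 1 + g (- 1) 0) = 0"
    using e1 e2 e3 e4 e5 e6 e7 e8 e9 by algebra
  then show ?thesis by (simp add: sk add_eq_0_iff)
qed

section \<open>Cocycle equations for the Witt algebra\<close>

context int_subgroup
begin

text \<open>Here \<open>a s t\<close> stands for the coefficient of L_s \<otimes> L_t in
  \<Delta>(L_(s+t)). The conclusion says that it agrees with the coefficient in L_(s+t) . r, where r
  is the sum of the \<alpha>(s) L_s \<otimes> L_(-s).\<close>

lemma LL_cocycle:
  fixes a :: "'a \<Rightarrow> 'a \<Rightarrow> 'a"
  assumes skew: "\<And>s t. s \<in> \<Gamma> \<Longrightarrow> t \<in> \<Gamma> \<Longrightarrow> a t s = - a s t"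
    and deg0: "\<And>s. s \<in> \<Gamma> \<Longrightarrow> a s (- s) = 0"
    and fin: "\<And>x. x \<in> \<Gamma> \<Longrightarrow> \<forall>\<^sub>F s in almost_all. a s (x - s) = 0"
    and eq: "\<And>s t x. s \<in> \<Gamma> \<Longrightarrow> t \<in> \<Gamma> \<Longrightarrow> x \<in> \<Gamma> \<Longrightarrow>
      (s + t - 2 * x) * a s t = (s - 2 * x) * a (s - x) t + (t - 2 * x) * a s (t - x)
        + (s + 2 * t - 2 * x) * a (x - t) t + (2 * s + t - 2 * x) * a s (x - s)"
  obtains \<alpha> where "\<And>s. s \<in> \<Gamma> \<Longrightarrow> \<alpha> (- s) = - \<alpha> s"
    and "\<And>s t. s \<in> \<Gamma> \<Longrightarrow> t \<in> \<Gamma> \<Longrightarrow> a s t = (s + 2 * t) * \<alpha> t - (t + 2 * s) * \<alpha> s"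
    and "\<forall>\<^sub>F s in almost_all. \<alpha> s = 0"
proof -
  \<comment> \<open>The equation is homogeneous in its indices, so restricting it to integer
    multiples of \<open>x\<close> and cancelling one factor \<open>x\<close> gives an instance over
    the integers.\<close>
  have even: "a 0 (- x) = a 0 x" if "x \<in> \<Gamma>" for x
  proof (cases "x = 0")
    case False
    define g where "g = (\<lambda>i j. a (of_int i * x) (of_int j * x))"
    have "g 0 1 = g 0 (- 1)"
    proof (rule witt_cocycle_multiples)
      show "g j i = - g i j" for i j
        using that by (auto simp: g_def intro: skew)
      show "g i (- i) = 0" for i
        using that deg0[of "of_int i * x"] by (simp add: g_def)
      show "of_int (i + j - 2 * k) * g i j =
          of_int (i - 2 * k) * g (i - k) j + of_int (j - 2 * k) * g i (j - k)
        + of_int (i + 2 * j - 2 * k) * g (k - j) j + of_int (2 * i + j - 2 * k) * g i (k - i)" for i j k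
      proof -
        have "x * (of_int (i + j - 2 * k) * g i j) =
          x * (of_int (i - 2 * k) * g (i - k) j + of_int (j - 2 * k) * g i (j - k)
        + of_int (i + 2 * j - 2 * k) * g (k - j) j + of_int (2 * i + j - 2 * k) * g i (k - i))"
          using eq[OF of_int_mult_mem[OF that, of i] of_int_mult_mem[OF that, of j] of_int_mult_mem[OF that, of k]]
          unfolding g_def by (simp add: algebra_simps)
        then show ?thesis using False by simp
      qed
    qed
    then show ?thesis by (simp add: g_def)
  qed simp
  \<comment> \<open>The formula to be proved, read at \<open>s = 0\<close> with
    \<open>\<alpha> 0 = 0\<close>, forces this choice. Division by zero supplies
    \<open>\<alpha> 0 = 0\<close>.\<close>
  define \<alpha> where "\<alpha> x = a 0 x / (2 * x)" for x
  have a00: "a 0 0 = 0" using deg0[of 0] by simp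
  have a0: "a 0 x = 2 * x * \<alpha> x" for x
    using a00 by (simp add: \<alpha>_def)
  have \<alpha>0: "\<alpha> 0 = 0" by (simp add: \<alpha>_def)
  have odd: "\<alpha> (- x) = - \<alpha> x" if "x \<in> \<Gamma>" for x
    using even[OF that] by (simp add: \<alpha>_def)
  define a' where "a' s t = a s t - ((s + 2 * t) * \<alpha> t - (t + 2 * s) * \<alpha> s)" for s t
  have skew': "a' t s = - a' s t" if "s \<in> \<Gamma>" "t \<in> \<Gamma>" for s t
    using skew[OF that] by (simp add: a'_def)
  \<comment> \<open>At \<open>s = 0\<close>, \<open>t = w\<close>, \<open>x = - u\<close> all but
    two terms are values of \<open>a 0\<close>, and evenness turns these into \<alpha> at
    \<open>u\<close>, \<open>v\<close>, \<open>w\<close>. The remaining two terms give the symmetry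
    of the deviation \<open>a'\<close>.\<close>
  have rot: "u * a' u w = v * a' v w" if "u \<in> \<Gamma>" "v \<in> \<Gamma>" "w = - u - v" for u v w
  proof -
    have "w \<in> \<Gamma>" using that by simp
    have "(w + 2 * u) * (2 * w * \<alpha> w) = 2 * u * a u w + (w + 2 * u) * (2 * v * \<alpha> v)
        - 2 * v * a v w + (w + 2 * u) * (2 * u * \<alpha> u)"
    proof -
      have "w + u = - v" "- u - w = v" "2 * w + 2 * u = - 2 * v" using that(3) by simp_all
      then have "(w + 2 * u) * a 0 w = 2 * u * a u w + (w + 2 * u) * a 0 (- v)
          - 2 * v * a v w + (w + 2 * u) * a 0 (- u)"
        using eq[of 0 w "- u"] that(1) \<open>w \<in> \<Gamma>\<close> by simp
      then show ?thesis using even[OF that(1)] even[OF that(2)] by (simp only: a0)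
    qed
    then have "2 * (u * a u w - v * a v w) = 2 * ((w + 2 * u) * (w * \<alpha> w - v * \<alpha> v - u * \<alpha> u))"
      by (simp add: algebra_simps)
    then have 1: "u * a u w - v * a v w = (w + 2 * u) * (w * \<alpha> w - v * \<alpha> v - u * \<alpha> u)"
      by (subst (asm) mult_left_cancel) simp_all
    have 2: "u * (u + 2 * w) - v * (v + 2 * w) = (w + 2 * u) * w" "v * (w + 2 * v) = - ((w + 2 * u) * v)"
      unfolding that(3) by (simp_all add: algebra_simps)
    have "u * a' u w - v * a' v w = (u * a u w - v * a v w) - (u * (u + 2 * w) - v * (v + 2 * w)) * \<alpha> w
        + (w + 2 * u) * u * \<alpha> u - v * (w + 2 * v) * \<alpha> v"
      by (simp add: a'_def algebra_simps)
    also have "\<dots> = 0" unfolding 1 2 by (simp add: algebra_simps)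
    finally show ?thesis by simp
  qed
  have a'0: "a' s t = 0" if st: "s \<in> \<Gamma>" "t \<in> \<Gamma>" for s t
  proof -
    consider "s = 0" | "t = 0" | "s + t = 0" | "s \<noteq> 0" "t \<noteq> 0" "s + t \<noteq> 0" by blast
    then show ?thesis
    proof cases
      case 1
      then show ?thesis by (simp add: a'_def a0 \<alpha>0)
    next
      case 2
      then show ?thesis using skew[of 0 s] st by (simp add: a'_def a0 \<alpha>0)
    next
      case 3
      then have "t = - s" by (simp add: add_eq_0_iff)
      then show ?thesis using deg0[of s] odd[of s] st by (simp add: a'_def)
    next
      case 4
      define w where "w = - s - t"
      have w: "w \<in> \<Gamma>" "w \<noteq> 0" using st 4 by (auto simp: w_def)
      have s_eq: "s = - t - w" and t_eq: "t = - w - s" by (simp_all add: w_def)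
      note r = rot[OF st w_def] rot[OF st(2) w(1) s_eq] rot[OF w(1) st(1) t_eq]
      \<comment> \<open>Going once around the triple \<open>s\<close>, \<open>t\<close>,
        \<open>w\<close> with sum zero returns to the same expression after three sign changes from
        skewness.\<close>
      have "s * (t * a' s t) = - (s * (t * a' t s))" by (simp add: skew'[OF st])
      also have "\<dots> = - (s * (w * a' w s))" by (simp only: r(2))
      also have "\<dots> = w * (s * a' s w)" by (simp add: skew'[OF st(1) w(1)])
      also have "\<dots> = w * (t * a' t w)" by (simp only: r(1))
      also have "\<dots> = - (t * (w * a' w t))" by (simp add: skew'[OF st(2) w(1)])
      also have "\<dots> = - (t * (s * a' s t))" by (simp only: r(3))
      finally have "2 * (s * t * a' s t) = 0" by simp
      then show ?thesis using 4 by simp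
    qed
  qed
  have aform: "a s t = (s + 2 * t) * \<alpha> t - (t + 2 * s) * \<alpha> s" if "s \<in> \<Gamma>" "t \<in> \<Gamma>" for s t
    using a'0[OF that] by (simp add: a'_def)
  have rec: "\<forall>\<^sub>F s in almost_all. (s - 2 * x) * \<alpha> (s - x) = (s + x) * \<alpha> s" if "x \<in> \<Gamma>" for x
    using fin[OF that] almost_all_mem
  proof eventually_elim
    case (elim s)
    have "\<alpha> (x - s) = - \<alpha> (s - x)" using odd[of "s - x"] elim that by simp
    then show ?case using elim that aform[of s "x - s"] by (simp add: algebra_simps)
  qed
  have "\<forall>\<^sub>F s in almost_all. \<alpha> s = 0"
    using rec[OF numeral_mem(2)] rec[of 2, OF numeral_mem(1)]
      almost_all_shift[OF minus_mem[OF numeral_mem(2)] rec[OF numeral_mem(2)]]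
      almost_all_neq[of 4] almost_all_neq[of 2] almost_all_neq[of 3]
  proof eventually_elim
    case (elim s)
    have "(s - 4) * \<alpha> (s - 2) = (s + 2) * \<alpha> s" "(s - 2) * \<alpha> (s - 1) = (s + 1) * \<alpha> s"
      "(s - 3) * \<alpha> (s - 2) = s * \<alpha> (s - 1)"
      using elim(1-3) by (simp_all add: algebra_simps)
    \<comment> \<open>One step of length 2 and two steps of length 1 both relate
      \<open>\<alpha> (s - 2)\<close> to \<open>\<alpha> s\<close>. The resulting cubic factors
      (s-2)(s-3)(s+2) and s(s+1)(s-4) differ by exactly 12.\<close>
    then have "12 * \<alpha> s = 0" by algebra
    then show ?case by simp
  qed
  with odd aform show ?thesis using that by blast
qed

text \<open>\<open>b s q\<close> stands for the coefficient of L_s \<otimes> I_q in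
  \<Delta>(L_(s+q)), and \<open>\<rho> q\<close> becomes the coefficient of L_(-q) \<otimes> I_q in
  r. Skewness relates this component to the I \<otimes> L one and gives no constraint within it, so
  finiteness of supports has to enter before the formula is reached.\<close>

lemma LI_cocycle:
  fixes b :: "'a \<Rightarrow> 'a \<Rightarrow> 'a"
  assumes deg0: "\<And>s. s \<in> \<Gamma> \<Longrightarrow> b s (- s) = 0"
    and fin: "\<And>x. x \<in> \<Gamma> \<Longrightarrow> \<forall>\<^sub>F s in almost_all. b s (x - s) = 0"
    and eq: "\<And>s q x. s \<in> \<Gamma> \<Longrightarrow> q \<in> \<Gamma> \<Longrightarrow> x \<in> \<Gamma> \<Longrightarrow> q \<noteq> 0 \<Longrightarrow>
      (s + q - 2 * x) * b s q = (s - 2 * x) * b (s - x) q + (q - x) * b s (q - x)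
        + (s + 2 * q - 2 * x) * b (x - q) q + (s - x) * b s (x - s)"
  obtains \<rho> where
      "\<And>s q. s \<in> \<Gamma> \<Longrightarrow> q \<in> \<Gamma> \<Longrightarrow> q \<noteq> 0 \<Longrightarrow> b s q = - s * \<rho> (- s) - (s + 2 * q) * \<rho> q"
    and "\<forall>\<^sub>F s in almost_all. \<rho> s = 0"
proof -
  define N where "N x w = b (- w) (x + w)" for x w
  have N0: "N 0 w = 0" if "w \<in> \<Gamma>" for w
    using deg0[of "- w"] that by (simp add: N_def)
  have Nfin: "\<forall>\<^sub>F w in almost_all. N x w = 0" if "x \<in> \<Gamma>" for x
    using almost_all_reflect[OF zero_mem fin[OF that]] by (simp add: N_def)
  have Neq: "(z - x) * N (x + z) w = - (w + 2 * x) * N z (x + w) + (z + w) * N z w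
      + (w + 2 * z) * N x (z + w) - (x + w) * N x w"
    if "x \<in> \<Gamma>" "z \<in> \<Gamma>" "w \<in> \<Gamma>" "x + z + w \<noteq> 0" for x z w
    using eq[of "- w" "x + z + w" x] that unfolding N_def by (simp add: algebra_simps)
  \<comment> \<open>In the target formula \<open>N z 0\<close> equals -2 z \<rho>(z). Hence
    \<open>\<tau> z\<close> is z \<rho>(z) and \<open>\<sigma> z\<close> is z^2 \<rho>(z), both read
    off from the coefficients at L_0 \<otimes> I_z.\<close>
  define \<sigma> where "\<sigma> z = - z * N z 0 / 2" for z
  define \<tau> where "\<tau> z = - N z 0 / 2" for z
  have \<sigma>\<tau>: "\<sigma> z = z * \<tau> z" for z by (simp add: \<sigma>_def \<tau>_def)
  have Nz: "\<forall>\<^sub>F z in almost_all. x * (z + x) * N z x = (z - x) * \<sigma> (z + x) - (z + x) * \<sigma> z + (z + x) * \<sigma> x"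
    if x: "x \<in> \<Gamma>" for x
    using almost_all_mem almost_all_neq[of "- x"] Nfin[OF x]
  proof eventually_elim
    case (elim z)
    then have "(z - x) * N (x + z) 0 = - 2 * x * N z x + z * N z 0 - x * N x 0"
      using Neq[of x z 0] x by (simp add: add_eq_0_iff)
    then show ?case by (simp add: \<sigma>_def field_simps) algebra
  qed
  \<comment> \<open>Take \<open>w = - x\<close> in \<open>Neq\<close>: for generic \<open>z\<close>
    the term \<open>N x (z - x)\<close> vanishes, and \<open>Nz\<close> replaces the other values by
    \<sigma>.\<close>
  have sec: "\<forall>\<^sub>F z in almost_all. (z - x) * \<sigma> (z + x) + (z + x) * \<sigma> (z - x) = 2 * z * \<sigma> z"
    if x: "x \<in> \<Gamma>" "x \<noteq> 0" for x
    using almost_all_mem almost_all_neq[of 0] almost_all_neq[of x] almost_all_shift[OF minus_mem[OF x(1)] Nfin[OF x(1)]]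
      Nz[OF minus_mem[OF x(1)]] almost_all_shift[OF x(1) Nz[OF minus_mem[OF x(1)]]]
  proof eventually_elim
    case (elim z)
    have 1: "(z - x) * N (x + z) (- x) = - x * N z 0 + (z - x) * N z (- x)"
      using Neq[of x z "- x"] x elim by (simp add: algebra_simps)
    have 2: "- x * (z - x) * N z (- x) = (z + x) * \<sigma> (z - x) - (z - x) * \<sigma> z + (z - x) * \<sigma> (- x)"
      using elim(5) by simp
    have 3: "- x * z * N (x + z) (- x) = (z + 2 * x) * \<sigma> z - z * \<sigma> (x + z) + z * \<sigma> (- x)"
      using elim(6) by (simp add: algebra_simps)
    have 4: "z * N z 0 = - 2 * \<sigma> z" by (simp add: \<sigma>_def)
    have "z * ((z - x) * \<sigma> (x + z) + (z + x) * \<sigma> (z - x)) = z * (2 * z * \<sigma> z)"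
      using 1 2 3 4 by algebra
    then show ?case using elim(2) by (simp add: add.commute)
  qed
  \<comment> \<open>Four instances of \<open>sec\<close>, with step \<open>x\<close> at
    \<open>z\<close>, \<open>z + x\<close>, \<open>z - x\<close> and step \<open>2 * x\<close> at
    \<open>z\<close>, involve five values of \<sigma>. Eliminating the outer ones leaves a multiple
    of \<open>\<sigma> (z + x) - \<sigma> z\<close> whose factor is nonzero for generic
    \<open>z\<close>.\<close>
  have inv: "\<forall>\<^sub>F z in almost_all. \<sigma> (z + x) = \<sigma> z" if x: "x \<in> \<Gamma>" for x
  proof (cases "x = 0")
    case False
    have x2: "2 * x \<in> \<Gamma>" "2 * x \<noteq> 0" using x False by simp_all
    show ?thesis
      using sec[OF x False] almost_all_shift[OF x sec[OF x False]] almost_all_shift[OF minus_mem[OF x] sec[OF x False]]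
        sec[OF x2] almost_all_neq[of 0] almost_all_neq[of "- x"] almost_all_neq[of x]
    proof eventually_elim
      case (elim z)
      have 1: "(z - x) * \<sigma> (z + x) + (z + x) * \<sigma> (z - x) = 2 * z * \<sigma> z"
        "z * \<sigma> (z + 2 * x) + (z + 2 * x) * \<sigma> z = 2 * (z + x) * \<sigma> (z + x)"
        "(z - 2 * x) * \<sigma> z + z * \<sigma> (z - 2 * x) = 2 * (z - x) * \<sigma> (z - x)"
        "(z - 2 * x) * \<sigma> (z + 2 * x) + (z + 2 * x) * \<sigma> (z - 2 * x) = 2 * z * \<sigma> z"
        using elim(1-4) False by (simp_all add: algebra_simps)
      define d where "d = \<sigma> (z + x) - \<sigma> z"
      have "(z + x) * (z * (x ^ 3 * d)) = 0"
        using 1 unfolding d_def by algebra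
      then have "d = 0" using elim False by (auto simp: add_eq_0_iff)
      then show ?case by (simp add: d_def)
    qed
  qed simp
  have Nz': "\<forall>\<^sub>F z in almost_all. (z + w) * N z w = - 2 * \<sigma> z + (z + w) * \<tau> w" if w: "w \<in> \<Gamma>" for w
  proof (cases "w = 0")
    case True
    then show ?thesis by (simp add: \<sigma>_def \<tau>_def N0)
  next
    case False
    show ?thesis using inv[OF w] Nz[OF w]
    proof eventually_elim
      case (elim z)
      then have "w * ((z + w) * N z w) = w * (- 2 * \<sigma> z + (z + w) * \<tau> w)"
        by (simp add: \<sigma>\<tau>[of w] algebra_simps)
      then show ?case using False by simp
    qed
  qed
  \<comment> \<open>For generic \<open>z\<close> the term \<open>N x (z + w)\<close> in
    \<open>Neq\<close> vanishes, and the values of \<open>N\<close> at \<open>z\<close> and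
    \<open>x + z\<close> are known from \<open>Nz'\<close>. Since \<sigma> agrees at
    \<open>z\<close> and \<open>z + x\<close>, its contributions cancel, which leaves an identity
    free of \<open>z\<close>.\<close>
  have Nform: "(x + w) * N x w = (x + w) * \<tau> w - (w + 2 * x) * \<tau> (x + w)" if x: "x \<in> \<Gamma>" and w: "w \<in> \<Gamma>" for x w
  proof -
    have "\<forall>\<^sub>F z in almost_all. (x + w) * N x w = (x + w) * \<tau> w - (w + 2 * x) * \<tau> (x + w)"
      using almost_all_mem almost_all_shift[OF w Nfin[OF x]] almost_all_neq[of "- (x + w)"] inv[OF x]
        Nz'[OF w] Nz'[OF add_mem[OF x w]] almost_all_shift[OF x Nz'[OF w]]
    proof eventually_elim
      case (elim z)
      have nz: "x + z + w \<noteq> 0" using elim(3) by (simp add: add_eq_0_iff algebra_simps)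
      have "(z - x) * N (x + z) w = - (w + 2 * x) * N z (x + w) + (z + w) * N z w - (x + w) * N x w"
        using Neq[of x z w] x w elim nz by simp
      moreover have "(x + z + w) * N (x + z) w = - 2 * \<sigma> z + (x + z + w) * \<tau> w"
        using elim(4,7) by (simp add: algebra_simps)
      moreover have "(x + z + w) * N z (x + w) = - 2 * \<sigma> z + (x + z + w) * \<tau> (x + w)"
        using elim(6) by (simp add: algebra_simps)
      moreover note elim(5)
      ultimately have "(x + z + w) * ((x + w) * N x w) = (x + z + w) * ((x + w) * \<tau> w - (w + 2 * x) * \<tau> (x + w))"
        by algebra
      then show ?case using nz by simp
    qed
    then show ?thesis by (simp add: almost_all_const)
  qed
  define \<rho> where "\<rho> z = \<tau> z / z" for z
  have "\<tau> 0 = 0" using N0[of 0] by (simp add: \<tau>_def)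
  then have \<tau>\<rho>: "\<tau> z = z * \<rho> z" for z by (simp add: \<rho>_def)
  have bform: "b s q = - s * \<rho> (- s) - (s + 2 * q) * \<rho> q" if "s \<in> \<Gamma>" "q \<in> \<Gamma>" "q \<noteq> 0" for s q
  proof -
    have "q * b s q = q * (- s * \<rho> (- s) - (s + 2 * q) * \<rho> q)"
      using Nform[of "s + q" "- s"] that by (simp add: N_def \<tau>\<rho> algebra_simps)
    then show ?thesis using that by simp
  qed
  have rec: "\<forall>\<^sub>F q in almost_all. (q - x) * \<rho> (q - x) = (q + x) * \<rho> q" if "x \<in> \<Gamma>" for x
    using almost_all_reflect[OF that fin[OF that]] almost_all_mem almost_all_neq[of 0]
  proof eventually_elim
    case (elim q)
    then show ?case using bform[of "x - q" q] that by (simp add: algebra_simps)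
  qed
  have "\<forall>\<^sub>F s in almost_all. \<rho> s = 0"
    using rec[OF numeral_mem(2)] rec[of 2, OF numeral_mem(1)]
      almost_all_shift[OF minus_mem[OF numeral_mem(2)] rec[OF numeral_mem(2)]]
  proof eventually_elim
    case (elim s)
    have "(s - 2) * \<rho> (s - 2) = (s + 2) * \<rho> s" "(s - 1) * \<rho> (s - 1) = (s + 1) * \<rho> s"
      "(s - 2) * \<rho> (s - 2) = s * \<rho> (s - 1)"
      using elim(1-3) by (simp_all add: algebra_simps)
    \<comment> \<open>Comparing one step of length 2 with two of length 1 gives the factors
      (s-1)(s+2) and s(s+1), which differ by the constant 2.\<close>
    then have "2 * \<rho> s = 0" by algebra
    then show ?case by simp
  qed
  with bform show ?thesis using that by blast
qed

text \<open>On every line p, p+1, p+2, ... the function is eventually constant, and translation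
  invariance makes the limit the same for all lines. Evenness gives the same limit in the negative
  direction; without it the sign function on the integers would be a counterexample. A point with
  another value therefore lies between two of the finitely many jumps \<open>S\<close>.\<close>

lemma even_almost_invariant:
  fixes f :: "'a \<Rightarrow> 'b"
  assumes even: "\<And>y. y \<in> \<Gamma> \<Longrightarrow> f (- y) = f y"
    and inv: "\<And>x. x \<in> \<Gamma> \<Longrightarrow> \<forall>\<^sub>F p in almost_all. f (p + x) = f p"
  obtains \<kappa> where "\<forall>\<^sub>F p in almost_all. f p = \<kappa>"
proof -
  define S where "S = {p \<in> \<Gamma>. f (p + 1) \<noteq> f p}"
  have finS: "finite S" using inv[of 1] by (simp add: S_def eventually_almost_all)
  have up: "f (p + of_nat n) = f p" if "p \<in> \<Gamma>" "\<And>k. k < n \<Longrightarrow> p + of_nat k \<notin> S" for p n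
    using that
  proof (induction n)
    case (Suc n)
    have "f (p + of_nat n + 1) = f (p + of_nat n)"
      using Suc.prems(1) Suc.prems(2)[of n] by (auto simp: S_def)
    with Suc show ?case by (simp add: algebra_simps)
  qed simp
  have leave: "\<exists>N. \<forall>n\<ge>N. p + of_nat n \<notin> T" if "finite T" for p :: 'a and T
  proof -
    have "finite ((\<lambda>n. p + of_nat n) -` T)"
      by (rule finite_vimageI) (use that in \<open>auto simp: inj_def\<close>)
    then obtain N where "\<forall>n\<in>(\<lambda>n. p + of_nat n) -` T. n < N"
      using finite_nat_set_iff_bounded by blast
    then show ?thesis by (meson leD vimageI)
  qed
  define N0 where "N0 = (SOME N. \<forall>n\<ge>N. (0::'a) + of_nat n \<notin> S)"
  have N0: "of_nat n \<notin> S" if "n \<ge> N0" for n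
    using someI_ex[OF leave[OF finS, of 0]] that by (simp add: N0_def)
  define \<kappa> where "\<kappa> = f (of_nat N0)"
  have nat\<kappa>: "f (of_nat n) = \<kappa>" if "n \<ge> N0" for n
    using up[of "of_nat N0" "n - N0"] N0 that by (simp add: \<kappa>_def of_nat_diff flip: of_nat_add)
  \<comment> \<open>Invariance under \<open>y\<close> is applied far out along the natural numbers,
    where \<open>f\<close> already has the value \<kappa>.\<close>
  have lim: "\<exists>N. \<forall>n\<ge>N. f (y + of_nat n) = \<kappa>" if y: "y \<in> \<Gamma>" for y
  proof -
    obtain N where "\<forall>n\<ge>N. (0::'a) + of_nat n \<notin> {p \<in> \<Gamma>. f (p + y) \<noteq> f p}"
      using leave[of "{p \<in> \<Gamma>. f (p + y) \<noteq> f p}" 0] inv[OF y] by (auto simp: eventually_almost_all)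
    then show ?thesis using nat\<kappa> by (intro exI[of _ "max N N0"]) (auto simp: algebra_simps)
  qed
  have right: "\<exists>k. p + of_nat k \<in> S" if "p \<in> \<Gamma>" "f p \<noteq> \<kappa>" for p
  proof (rule ccontr)
    assume "\<nexists>k. p + of_nat k \<in> S"
    then have "f (p + of_nat n) = f p" for n using up[OF that(1)] by blast
    then show False using lim[OF that(1)] that(2) by auto
  qed
  have left: "\<exists>k. p - of_nat k \<in> (\<lambda>s. s + 1) ` S" if p: "p \<in> \<Gamma>" "f p \<noteq> \<kappa>" for p
  proof -
    obtain k where k: "- p + of_nat k \<in> S" using right[of "- p"] p even by auto
    then have "f (p - of_nat k - 1) \<noteq> f (p - of_nat k)"
      using p even[of "- p + of_nat k"] even[of "- p + of_nat k + 1"] by (simp add: S_def algebra_simps)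
    then have "p - of_nat k - 1 \<in> S" using p by (auto simp: S_def)
    then show ?thesis by (intro exI[of _ k] image_eqI[of _ _ "p - of_nat k - 1"]) auto
  qed
  \<comment> \<open>\<open>A\<close> collects the points lying an integer distance to the left of
    one jump and to the right of another. For each pair of jumps there are finitely many, or none if
    the jumps are in different cosets of the integers.\<close>
  define A where "A = (\<Union>s\<in>S. \<Union>s'\<in>(\<lambda>s. s + 1) ` S. {p. \<exists>k m. p = s - of_nat k \<and> p = s' + of_nat m})"
  have "finite {p. \<exists>k m. p = s - of_nat k \<and> p = s' + of_nat m}" for s s' :: 'a
  proof (cases "\<exists>n. s - s' = of_nat n")
    case True
    then obtain n where n: "s - s' = of_nat n" by blast
    have "{p. \<exists>k m. p = s - of_nat k \<and> p = s' + of_nat m} \<subseteq> (\<lambda>m. s' + of_nat m) ` {..n}"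
    proof
      fix p assume "p \<in> {p. \<exists>k m. p = s - of_nat k \<and> p = s' + of_nat m}"
      then obtain k m where km: "p = s - of_nat k" "p = s' + of_nat m" by blast
      then have "s - s' = of_nat (k + m)" by (simp add: algebra_simps)
      with n have "n = k + m" by (metis of_nat_eq_iff)
      with km(2) show "p \<in> (\<lambda>m. s' + of_nat m) ` {..n}" by auto
    qed
    then show ?thesis using finite_surj by blast
  next
    case False
    have "{p. \<exists>k m. p = s - of_nat k \<and> p = s' + of_nat m} = {}"
    proof (rule ccontr)
      assume "{p. \<exists>k m. p = s - of_nat k \<and> p = s' + of_nat m} \<noteq> {}"
      then obtain k m where "s - of_nat k = s' + of_nat m" by force
      then have "s - s' = of_nat (k + m)" by (simp add: algebra_simps)
      with False show False by blast
    qed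
    then show ?thesis by (simp only: finite.emptyI)
  qed
  then have "finite A" using finS unfolding A_def by (intro finite_UN_I finite_imageI) auto
  moreover have "{p \<in> \<Gamma>. f p \<noteq> \<kappa>} \<subseteq> A"
  proof
    fix p assume "p \<in> {p \<in> \<Gamma>. f p \<noteq> \<kappa>}"
    then obtain k m where "p + of_nat k \<in> S" "p - of_nat m \<in> (\<lambda>s. s + 1) ` S"
      using left[of p] right[of p] by auto
    then show "p \<in> A" unfolding A_def
      by (intro UN_I[of "p + of_nat k"] UN_I[of "p - of_nat m"] CollectI exI[of _ k] exI[of _ m]) auto
  qed
  ultimately show ?thesis
    using that[of \<kappa>] finite_subset by (auto simp: eventually_almost_all)
qed

text \<open>\<open>c p q\<close> stands for the coefficient of I_p \<otimes> I_q in
  \<Delta>(L_(p+q)), and \<open>f p / p\<close> becomes the coefficient of I_p \<otimes> I_(-p) in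
  r. The method is to study \<open>q \<mapsto> c p q\<close> for generic \<open>q\<close>: it is
  almost additive under shifts, and skewness forces the increments to vanish.\<close>

lemma II_cocycle:
  fixes c :: "'a \<Rightarrow> 'a \<Rightarrow> 'a"
  assumes skew: "\<And>p q. p \<in> \<Gamma> \<Longrightarrow> q \<in> \<Gamma> \<Longrightarrow> c q p = - c p q"
    and fin: "\<And>x. x \<in> \<Gamma> \<Longrightarrow> \<forall>\<^sub>F p in almost_all. c p (x - p) = 0"
    and eq: "\<And>p q x. p \<in> \<Gamma> \<Longrightarrow> q \<in> \<Gamma> \<Longrightarrow> x \<in> \<Gamma> \<Longrightarrow> p \<noteq> 0 \<Longrightarrow> q \<noteq> 0 \<Longrightarrow>
      (p + q - 2 * x) * c p q = (p - x) * c (p - x) q + (q - x) * c p (q - x)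
        + (q - x) * c (x - q) q + (p - x) * c p (x - p)"
  obtains f where "\<And>p. p \<in> \<Gamma> \<Longrightarrow> f (- p) = f p"
    and "\<And>p q. p \<in> \<Gamma> \<Longrightarrow> q \<in> \<Gamma> \<Longrightarrow> p \<noteq> 0 \<Longrightarrow> q \<noteq> 0 \<Longrightarrow> c p q = f q - f p"
    and "\<forall>\<^sub>F p in almost_all. f p = 0"
proof -
  have diag: "c p p = 0" if "p \<in> \<Gamma>" for p using skew[OF that that] by simp
  \<comment> \<open>The equation at \<open>x = p - y\<close>: its term
    \<open>c (p - y - q) q\<close> belongs to \<Delta>(L_(p-y)) and so vanishes for all but finitely
    many \<open>q\<close>.\<close>
  have star: "\<forall>\<^sub>F q in almost_all. (q - p + 2 * y) * c p q
      = y * c y q + (q - p + y) * c p (q - p + y) + y * c p (- y)"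
    if p: "p \<in> \<Gamma>" "p \<noteq> 0" and y: "y \<in> \<Gamma>" for p y
    using almost_all_reflect[OF diff_mem[OF p(1) y] fin[OF diff_mem[OF p(1) y]]] almost_all_mem almost_all_neq[of 0]
  proof eventually_elim
    case (elim q)
    then show ?case using eq[of p q "p - y"] p y by (simp add: algebra_simps)
  qed
  have per': "\<forall>\<^sub>F q in almost_all. c p (q - p) = c p q" if p: "p \<in> \<Gamma>" "p \<noteq> 0" for p
    using star[OF p zero_mem] almost_all_neq[of p] by eventually_elim simp
  have per: "\<forall>\<^sub>F q in almost_all. c p (q + p) = c p q" if p: "p \<in> \<Gamma>" "p \<noteq> 0" for p
    using almost_all_shift[OF p(1) per'[OF p]] by eventually_elim simp
  have neg: "\<forall>\<^sub>F q in almost_all. c (- p) q = c p q" if p: "p \<in> \<Gamma>" "p \<noteq> 0" for p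
    using star[OF p minus_mem[OF p(1)]] per'[OF p] almost_all_shift[OF minus_mem[OF p(1)] per'[OF p]]
  proof eventually_elim
    case (elim q)
    have "c p (q - p - p) = c p q" using elim by simp
    then have "p * c (- p) q = p * c p q" using elim diag[OF p(1)] by (simp add: algebra_simps)
    then show ?case using p by simp
  qed
  \<comment> \<open>\<open>\<theta> p y\<close> turns out to be the increment of \<open>c p\<close>
    under a generic shift by \<open>y\<close>.\<close>
  define \<theta> where "\<theta> p y = (c p y - c p (- y)) / 2" for p y
  have star': "\<forall>\<^sub>F q in almost_all. (q - p + 2 * y) * c p q
      = y * c y q + (q - p + y) * c p (q + y) + y * c p (- y)"
    if p: "p \<in> \<Gamma>" "p \<noteq> 0" and y: "y \<in> \<Gamma>" for p y
    using star[OF p y] almost_all_shift[OF y per'[OF p]]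
    by eventually_elim (simp add: algebra_simps)
  \<comment> \<open>Use \<open>star'\<close> at \<open>q\<close> with \<open>y\<close> and at
    \<open>q + y\<close> with \<open>- y\<close>. By \<open>per\<close> and \<open>neg\<close> the
    terms \<open>c y\<close> and \<open>c (- y)\<close> at these points agree, so they can be
    eliminated.\<close>
  have shift: "\<forall>\<^sub>F q in almost_all. c p (q + y) = c p q + \<theta> p y"
    if p: "p \<in> \<Gamma>" "p \<noteq> 0" and y: "y \<in> \<Gamma>" for p y
  proof (cases "y = 0")
    case False
    note y' = y False
    show ?thesis
      using star'[OF p y] almost_all_shift[OF y star'[OF p minus_mem[OF y]]] per[OF y']
        almost_all_shift[OF y neg[OF y']]
    proof eventually_elim
      case (elim q)
      have 1: "(q - p + 2 * y) * c p q = y * c y q + (q - p + y) * c p (q + y) + y * c p (- y)"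
        using elim(1) .
      have 2: "(q - p - y) * c p (q + y) = - y * c y q + (q - p) * c p q - y * c p y"
        using elim(2-4) by (simp add: algebra_simps)
      from 1 2 have "y * (c p (q + y) * 2) = y * (c p q * 2 + (c p y - c p (- y)))"
        by algebra
      then have "c p (q + y) * 2 = c p q * 2 + (c p y - c p (- y))" using False by simp
      then show ?case by (simp add: \<theta>_def field_simps)
    qed
  qed (simp add: \<theta>_def)
  have \<theta>_add: "\<theta> p (y + z) = \<theta> p y + \<theta> p z" if p: "p \<in> \<Gamma>" "p \<noteq> 0" and y: "y \<in> \<Gamma>" "z \<in> \<Gamma>" for p y z
  proof -
    have "\<forall>\<^sub>F q in almost_all. \<theta> p (y + z) = \<theta> p y + \<theta> p z"
      using shift[OF p y(1)] shift[OF p add_mem[OF y]] almost_all_shift[OF y(1) shift[OF p y(2)]]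
      by eventually_elim (simp add: algebra_simps)
    then show ?thesis by (simp add: almost_all_const)
  qed
  \<comment> \<open>Subtract \<open>star'\<close> at \<open>q\<close> from \<open>star'\<close> at
    \<open>q + p\<close>; \<open>c p\<close> is unchanged by the shift while \<open>c y\<close>
    grows by \<open>\<theta> y p\<close>.\<close>
  have \<theta>_swap: "p * \<theta> p y = - y * \<theta> y p" if p: "p \<in> \<Gamma>" "p \<noteq> 0" and y: "y \<in> \<Gamma>" "y \<noteq> 0" for p y
  proof -
    have "\<forall>\<^sub>F q in almost_all. p * \<theta> p y = - y * \<theta> y p"
      using star'[OF p y(1)] almost_all_shift[OF p(1) star'[OF p y(1)]] shift[OF p y(1)]
        almost_all_shift[OF p(1) shift[OF p y(1)]] per[OF p] shift[OF y p(1)]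
    proof eventually_elim
      case (elim q)
      have "(q - p + 2 * y) * c p q = y * c y q + (q - p + y) * (c p q + \<theta> p y) + y * c p (- y)"
        "(q + 2 * y) * c p q = y * (c y q + \<theta> y p) + (q + y) * (c p q + \<theta> p y) + y * c p (- y)"
        using elim by simp_all
      then show ?case by algebra
    qed
    then show ?thesis by (simp add: almost_all_const)
  qed
  \<comment> \<open>Skewness moves the evenness \<open>neg\<close> in the first index to the second
    index, so that \<open>\<theta> y p = 0\<close> for generic \<open>y\<close>;
    \<open>\<theta>_swap\<close> then exchanges the arguments.\<close>
  have \<theta>_ev: "\<forall>\<^sub>F y in almost_all. \<theta> p y = 0" if p: "p \<in> \<Gamma>" "p \<noteq> 0" for p
    using neg[OF p] almost_all_mem almost_all_neq[of 0]
  proof eventually_elim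
    case (elim y)
    have "\<theta> y p = 0" using elim skew[of p y] skew[of "- p" y] p by (simp add: \<theta>_def)
    then show ?case using \<theta>_swap[OF p, of y] elim p by simp
  qed
  \<comment> \<open>An additive function vanishing at almost every point vanishes everywhere: write
    \<open>y\<close> as the difference of \<open>y + z\<close> and \<open>z\<close> with generic
    \<open>z\<close>.\<close>
  have \<theta>0: "\<theta> p y = 0" if p: "p \<in> \<Gamma>" "p \<noteq> 0" and y: "y \<in> \<Gamma>" for p y
  proof -
    have "\<forall>\<^sub>F z in almost_all. \<theta> p y = 0"
      using \<theta>_ev[OF p] almost_all_shift[OF y \<theta>_ev[OF p]] almost_all_mem
    proof eventually_elim
      case (elim z)
      then show ?case using \<theta>_add[OF p y, of z] by (simp add: add.commute)
    qed
    then show ?thesis by (simp add: almost_all_const)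
  qed
  have cneg: "c p (- y) = c p y" if "p \<in> \<Gamma>" "p \<noteq> 0" "y \<in> \<Gamma>" for p y
    using \<theta>0[OF that] by (simp add: \<theta>_def)
  have diff: "\<forall>\<^sub>F q in almost_all. c p q - c y q = c p y" if p: "p \<in> \<Gamma>" "p \<noteq> 0" and y: "y \<in> \<Gamma>" "y \<noteq> 0" for p y
    using star'[OF p y(1)] shift[OF p y(1)]
  proof eventually_elim
    case (elim q)
    then have "y * (c p q - c y q) = y * c p y"
      using \<theta>0[OF p y(1)] cneg[OF p y(1)] by (simp add: algebra_simps)
    then show ?case using y by simp
  qed
  define f where "f = c 1"
  have even: "f (- p) = f p" if "p \<in> \<Gamma>" for p using cneg that by (simp add: f_def)
  have cform: "c p q = f q - f p" if p: "p \<in> \<Gamma>" "q \<in> \<Gamma>" "p \<noteq> 0" "q \<noteq> 0" for p q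
  proof -
    have "\<forall>\<^sub>F z in almost_all. c p q = f q - f p"
      using diff[of p q, OF p(1,3,2,4)] diff[OF numeral_mem(2) one_neq_zero p(1,3)]
        diff[OF numeral_mem(2) one_neq_zero p(2,4)]
      by eventually_elim (use p in \<open>auto simp: f_def algebra_simps\<close>)
    then show ?thesis by (simp add: almost_all_const)
  qed
  have "\<forall>\<^sub>F p in almost_all. f (p + x) = f p" if x: "x \<in> \<Gamma>" for x
    using almost_all_neq[of 0] almost_all_neq[of "- x"] almost_all_mem fin[OF minus_mem[OF x]]
  proof eventually_elim
    case (elim p)
    have "- x - p \<noteq> 0" using elim(2) by algebra
    then have "c p (- x - p) = f (- x - p) - f p"
      using elim x by (intro cform) auto
    moreover have "- x - p = - (p + x)" by simp
    then have "f (- x - p) = f (p + x)" using even[OF add_mem[OF elim(3) x]] by (simp only:)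
    ultimately show ?case using elim(4) by simp
  qed
  then obtain \<kappa> where \<kappa>: "\<forall>\<^sub>F p in almost_all. f p = \<kappa>"
    using even_almost_invariant[of f] even by blast
  \<comment> \<open>Only differences of \<open>f\<close> enter \<open>c\<close>, so the generic
    value \<kappa> may be subtracted; this makes the support finite.\<close>
  show ?thesis
    by (rule that[of "\<lambda>p. f p - \<kappa>"]) (use even cform \<kappa> in auto)
qed

section \<open>Homogeneous equations for the values on the I_y\<close>

text \<open>\<open>e s t\<close> stands for the coefficient of L_s \<otimes> L_t in
  \<Delta>(I_(s+t)). For generic \<open>s'\<close>, finite support kills
  \<open>e s' (s + t - s')\<close>; \<open>right\<close> carries this to \<open>e s' t\<close> and
  \<open>left\<close> to \<open>e s t\<close>. This path needs \<open>s + 2 * t \<noteq> 0\<close>.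
  Otherwise the two factors exchange roles, which needs \<open>2 * s + t \<noteq> 0\<close>; both
  sums cannot vanish, since they add up to 3(s+t).\<close>

lemma hom_LL:
  fixes e :: "'a \<Rightarrow> 'a \<Rightarrow> 'a"
  assumes fin: "\<And>x. x \<in> \<Gamma> \<Longrightarrow> x \<noteq> 0 \<Longrightarrow> \<forall>\<^sub>F s in almost_all. e s (x - s) = 0"
    and left: "\<And>s s' t. \<lbrakk>s \<in> \<Gamma>; s' \<in> \<Gamma>; t \<in> \<Gamma>; s + t \<noteq> 0; s' + t \<noteq> 0; s + s' + t \<noteq> 0\<rbrakk> \<Longrightarrow>
      (s' + t) * e s t = (s + t) * e s' t"
    and right: "\<And>s t t'. \<lbrakk>s \<in> \<Gamma>; t \<in> \<Gamma>; t' \<in> \<Gamma>; s + t \<noteq> 0; s + t' \<noteq> 0; s + t + t' \<noteq> 0\<rbrakk> \<Longrightarrow>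
      (s + t') * e s t = (s + t) * e s t'"
    and st: "s \<in> \<Gamma>" "t \<in> \<Gamma>" "s + t \<noteq> 0"
  shows "e s t = 0"
proof (cases "s + 2 * t = 0")
  case False
  have "\<forall>\<^sub>F s' in almost_all. e s t = 0"
    using almost_all_mem fin[OF add_mem[OF st(1,2)] st(3)] almost_all_neq[of "- t"] almost_all_neq[of "- (s + t)"]
  proof eventually_elim
    case (elim s')
    have nz: "s' + t \<noteq> 0" "s + s' + t \<noteq> 0" using elim(3,4) by algebra+
    have nz': "s' + (s + t - s') + t \<noteq> 0" using False by algebra
    have "(s' + (s + t - s')) * e s' t = (s' + t) * e s' (s + t - s')"
      using st elim nz nz' by (intro right) auto
    then have "e s' t = 0" using elim st by simp
    then show ?case using left[of s s' t] elim st nz by simp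
  qed
  then show ?thesis by (simp add: almost_all_const)
next
  case True
  have False': "2 * s + t \<noteq> 0"
  proof
    assume "2 * s + t = 0"
    with True have "3 * (s + t) = 0" by algebra
    with st(3) show False by (metis mult_eq_0_iff zero_neq_numeral)
  qed
  have "\<forall>\<^sub>F t' in almost_all. e s t = 0"
    using almost_all_mem almost_all_reflect[OF add_mem[OF st(1,2)] fin[OF add_mem[OF st(1,2)] st(3)]]
      almost_all_neq[of "- s"] almost_all_neq[of "- (s + t)"]
  proof eventually_elim
    case (elim t')
    have nz: "s + t' \<noteq> 0" "s + t + t' \<noteq> 0" using elim(3,4) by algebra+
    have nz': "s + t - t' + s + t' \<noteq> 0" using False' by algebra
    have "((s + t - t') + t') * e s t' = (s + t') * e (s + t - t') t'"
      using st elim nz nz' by (intro left) auto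
    then have "e s t' = 0" using elim st by simp
    then show ?case using right[of s t t'] elim st nz by simp
  qed
  then show ?thesis by (simp add: almost_all_const)
qed

text \<open>\<open>G u q\<close> stands for the coefficient of L_u \<otimes> I_q in
  \<Delta>(I_(u+q)). The choice \<open>x = q\<close> removes one term and gives a recursion in
  \<open>u\<close>, from which \<open>G m q = 0\<close> for fixed nonzero \<open>m\<close> and
  generic \<open>q\<close>.\<close>

lemma hom_LI:
  fixes G :: "'a \<Rightarrow> 'a \<Rightarrow> 'a"
  assumes fin: "\<And>x. x \<in> \<Gamma> \<Longrightarrow> x \<noteq> 0 \<Longrightarrow> \<forall>\<^sub>F s in almost_all. G s (x - s) = 0"
    and eq: "\<And>u q x. u \<in> \<Gamma> \<Longrightarrow> q \<in> \<Gamma> \<Longrightarrow> x \<in> \<Gamma> \<Longrightarrow> q \<noteq> 0 \<Longrightarrow> x \<noteq> u + q \<Longrightarrow>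
      (u + q - x) * G u q = (u - 2 * x) * G (u - x) q + (q - x) * G u (q - x)"
    and uq: "u \<in> \<Gamma>" "q \<in> \<Gamma>" "q \<noteq> 0"
  shows "G u q = 0"
proof -
  have step: "u * G u q = (u - 2 * q) * G (u - q) q" if "u \<in> \<Gamma>" "q \<in> \<Gamma>" "q \<noteq> 0" "u \<noteq> 0" for u q
    using eq[of u q q] that by simp
  have ev: "\<forall>\<^sub>F q in almost_all. G m q = 0" if m: "m \<in> \<Gamma>" "m \<noteq> 0" for m
    using almost_all_mem almost_all_neq[of 0] almost_all_reflect[OF m(1) fin[OF m]]
  proof eventually_elim
    case (elim q)
    then show ?case using step[of m q] m by simp
  qed
  have main: "G u q = 0" if u: "u \<in> \<Gamma>" "q \<in> \<Gamma>" "q \<noteq> 0" "u \<noteq> 0" for u q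
  proof -
    \<comment> \<open>The equation at \<open>x = u - v\<close>; by \<open>ev\<close> its last term
      \<open>G u (q + v - u)\<close> vanishes for generic \<open>v\<close>.\<close>
    have form: "\<forall>\<^sub>F v in almost_all. (q + v) * G u q = (2 * v - u) * G v q"
      using almost_all_mem almost_all_shift[OF diff_mem[OF u(2,1)] ev[OF u(1,4)]] almost_all_neq[of "- q"]
    proof eventually_elim
      case (elim v)
      have nz: "u - v \<noteq> u + q" using elim(3) by algebra
      have "(u + q - (u - v)) * G u q = (u - 2 * (u - v)) * G (u - (u - v)) q + (q - (u - v)) * G u (q - (u - v))"
        using u elim nz by (intro eq) auto
      then show ?case using elim by (simp add: algebra_simps)
    qed
    have q4: "4 * q \<noteq> 0" using u by simp
    have "\<forall>\<^sub>F v in almost_all. G u q = 0"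
      using form almost_all_shift[OF minus_mem[OF u(2)] form] almost_all_mem almost_all_neq[of 0]
        almost_all_neq_mult[OF q4, of "2 * q * q + 3 * u * q"]
    proof eventually_elim
      case (elim v)
      have 1: "v * G v q = (v - 2 * q) * G (v - q) q" using step[of v q] u elim by simp
      have 2: "(q + v) * G u q = (2 * v - u) * G v q" using elim(1) .
      have 3: "v * G u q = (2 * v - 2 * q - u) * G (v - q) q" using elim(2) by (simp add: algebra_simps)
      have "(2 * v - 2 * q - u) * (v * ((q + v) * G u q)) = (2 * v - u) * ((2 * v - 2 * q - u) * (v * G v q))"
        unfolding 2 by (simp only: mult_ac)
      also have "\<dots> = (2 * v - u) * ((v - 2 * q) * (v * G u q))"
        unfolding 1 3 by (simp only: mult_ac)
      \<comment> \<open>\<open>form\<close> at \<open>v\<close> and at \<open>v - q\<close> must be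
        compatible with the recursion \<open>step\<close> from \<open>v\<close> to
        \<open>v - q\<close>. The mismatch is a nonzero polynomial in \<open>v\<close>, and generic
        \<open>v\<close> avoids its roots.\<close>
      finally have "v * ((4 * q * v - (2 * q * q + 3 * u * q)) * G u q) = 0"
        by (simp add: algebra_simps)
      then show ?case using elim by simp
    qed
    then show ?thesis by (simp add: almost_all_const)
  qed
  show ?thesis
  proof (cases "u = 0")
    case True
    then show ?thesis using step[of q q] main[of q q] uq by simp
  qed (use main uq in auto)
qed

text \<open>Taking \<open>x\<close> equal to one of the indices shows that each row and each column
  is almost everywhere zero. For generic \<open>x\<close> both terms on the right of
  \<open>eq\<close> then vanish.\<close>

lemma hom_II:
  fixes d :: "'a \<Rightarrow> 'a \<Rightarrow> 'a"
  assumes fin: "\<And>x. x \<in> \<Gamma> \<Longrightarrow> x \<noteq> 0 \<Longrightarrow> \<forall>\<^sub>F s in almost_all. d s (x - s) = 0"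
    and eq: "\<And>p q x. p \<in> \<Gamma> \<Longrightarrow> q \<in> \<Gamma> \<Longrightarrow> x \<in> \<Gamma> \<Longrightarrow> p \<noteq> 0 \<Longrightarrow> q \<noteq> 0 \<Longrightarrow> x \<noteq> p + q \<Longrightarrow>
      (p + q - x) * d p q = (p - x) * d (p - x) q + (q - x) * d p (q - x)"
    and pq: "p \<in> \<Gamma>" "q \<in> \<Gamma>" "p \<noteq> 0" "q \<noteq> 0"
  shows "d p q = 0"
proof -
  have right: "\<forall>\<^sub>F q in almost_all. d m q = 0" if m: "m \<in> \<Gamma>" "m \<noteq> 0" for m
    using almost_all_mem almost_all_neq[of 0] almost_all_reflect[OF m(1) fin[OF m]]
  proof eventually_elim
    case (elim q)
    then show ?case using eq[of m q q] m by simp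
  qed
  have left: "\<forall>\<^sub>F p in almost_all. d p m = 0" if m: "m \<in> \<Gamma>" "m \<noteq> 0" for m
    using almost_all_mem almost_all_neq[of 0] fin[OF m]
  proof eventually_elim
    case (elim p)
    then show ?case using eq[of p m p] m by simp
  qed
  have "\<forall>\<^sub>F x in almost_all. d p q = 0"
    using almost_all_mem almost_all_neq[of "p + q"] almost_all_reflect[OF pq(1) left[OF pq(2,4)]]
      almost_all_reflect[OF pq(2) right[OF pq(1,3)]]
  proof eventually_elim
    case (elim x)
    then show ?case using eq[of p q x] pq by simp
  qed
  then show ?thesis by (simp add: almost_all_const)
qed

end

section \<open>The action on tensors\<close>

fun hv_deg :: "'a hvb \<Rightarrow> 'a" where
  "hv_deg (Lb x) = x"
| "hv_deg (Ib x) = x"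

text \<open>Bracketing with a basis vector \<open>b\<close> sends basis vectors to multiples of
  basis vectors, and at most one of them contributes at a given \<open>c\<close>. So the coefficient
  of [b, v] at \<open>c\<close> is \<open>br_coeff b c * v (br_pre b c)\<close>, and
  \<open>br_post\<close> goes back to the target. Where \<open>br_coeff\<close> is zero the index is
  an arbitrary default; its case \<open>q = 0\<close> encodes the convention I_0 = 0.\<close>

fun br_pre :: "'a::field hvb \<Rightarrow> 'a hvb \<Rightarrow> 'a hvb" where
  "br_pre (Lb x) (Lb s) = Lb (s - x)"
| "br_pre (Lb x) (Ib q) = Ib (q - x)"
| "br_pre (Ib y) (Ib q) = Lb (q - y)"
| "br_pre (Ib y) (Lb s) = Lb s"

fun br_coeff :: "'a::field hvb \<Rightarrow> 'a hvb \<Rightarrow> 'a" where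
  "br_coeff (Lb x) (Lb s) = s - 2 * x"
| "br_coeff (Lb x) (Ib q) = (if q = 0 then 0 else q - x)"
| "br_coeff (Ib y) (Ib q) = (if q = 0 then 0 else - y)"
| "br_coeff (Ib y) (Lb s) = 0"

fun br_post :: "'a::field hvb \<Rightarrow> 'a hvb \<Rightarrow> 'a hvb" where
  "br_post (Lb x) (Lb s) = Lb (s + x)"
| "br_post (Lb x) (Ib q) = Ib (q + x)"
| "br_post (Ib y) (Lb s) = Ib (s + y)"
| "br_post (Ib y) (Ib s) = Ib s"

lemma hv_br_basis_eq: "hv_br_basis b d c = (if d = br_pre b c then br_coeff b c else 0)"
  by (cases b; cases d; cases c) (auto simp: delta_def algebra_simps)

lemma br_post_pre: "br_coeff b c \<noteq> 0 \<Longrightarrow> br_post b (br_pre b c) = c"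
  by (cases b; cases c) auto

lemma hsupp_delta [simp]: "hsupp (delta b :: 'b \<Rightarrow> 'a::zero_neq_one) = {b}"
  by (auto simp: hsupp_def delta_def)

lemma delta_same [simp]: "delta b b = 1"
  by (simp add: delta_def)

lemma hv_bracket_delta [simp]: "hv_bracket (delta b) (delta b') = hv_br_basis b b'"
  by (simp add: hv_bracket_def)

definition hv_act :: "'a::field hvb \<Rightarrow> ('a hvb \<times> 'a hvb \<Rightarrow> 'a) \<Rightarrow> 'a hvb \<times> 'a hvb \<Rightarrow> 'a" where
  "hv_act b t = (\<lambda>(c1, c2). br_coeff b c1 * t (br_pre b c1, c2) + br_coeff b c2 * t (c1, br_pre b c2))"

text \<open>Away from characteristic 2 this is Im(1 - \<tau>), described by coefficients and thus
  without reference to a preimage.\<close>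

definition hv_skew2 :: "'a::field set \<Rightarrow> ('a hvb \<times> 'a hvb \<Rightarrow> 'a) set" where
  "hv_skew2 \<Gamma> = {t \<in> hv_carrier2 \<Gamma>. \<forall>c d. t (d, c) = - t (c, d)}"

lemma hv_skew2I: "t \<in> hv_carrier2 \<Gamma> \<Longrightarrow> (\<And>c d. t (d, c) = - t (c, d)) \<Longrightarrow> t \<in> hv_skew2 \<Gamma>"
  unfolding hv_skew2_def by blast

lemma hv_skew2_carrier: "t \<in> hv_skew2 \<Gamma> \<Longrightarrow> t \<in> hv_carrier2 \<Gamma>"
  unfolding hv_skew2_def by blast

lemma hv_skew2_swap: "t \<in> hv_skew2 \<Gamma> \<Longrightarrow> t (d, c) = - t (c, d)"
  unfolding hv_skew2_def by blast

lemma hv_act2_expand: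
  assumes "finite (hsupp t)"
  shows "hv_act2 x t p = (\<Sum>b\<in>hsupp x. x b * hv_act b t p)"
proof (cases p)
  case (Pair c1 c2)
  have br: "hv_bracket x (delta d) c = (\<Sum>b\<in>hsupp x. x b * hv_br_basis b d c)" for d c
    by (simp add: hv_bracket_def)
  have one: "(\<Sum>p\<in>hsupp t. t p * (if p = q then k else 0)) = k * t q" for q and k :: 'a
    using assms by (auto simp: if_distrib[of "(*) _"] sum.delta' hsupp_def cong: if_cong)
  have "(\<Sum>p\<in>hsupp t. t p * (hv_br_basis b (fst p) c1 * delta (snd p) c2
        + delta (fst p) c1 * hv_br_basis b (snd p) c2)) = hv_act b t (c1, c2)" for b
  proof -
    have "(\<Sum>p\<in>hsupp t. t p * (hv_br_basis b (fst p) c1 * delta (snd p) c2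
        + delta (fst p) c1 * hv_br_basis b (snd p) c2))
      = (\<Sum>p\<in>hsupp t. t p * (if p = (br_pre b c1, c2) then br_coeff b c1 else 0)
          + t p * (if p = (c1, br_pre b c2) then br_coeff b c2 else 0))"
      by (rule sum.cong) (auto simp: hv_br_basis_eq delta_def algebra_simps)
    also have "\<dots> = hv_act b t (c1, c2)"
      by (simp add: sum.distrib one hv_act_def)
    finally show ?thesis .
  qed
  then have "(\<Sum>b\<in>hsupp x. x b * hv_act b t (c1, c2)) = (\<Sum>b\<in>hsupp x. x b * (\<Sum>p\<in>hsupp t. t p *
      (hv_br_basis b (fst p) c1 * delta (snd p) c2 + delta (fst p) c1 * hv_br_basis b (snd p) c2)))"
    by simp
  also have "\<dots> = hv_act2 x t (c1, c2)"
    unfolding hv_act2_def br prod.case sum_distrib_left sum_distrib_right sum.distrib[symmetric]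
    by (subst sum.swap, intro sum.cong refl) (simp add: algebra_simps sum.distrib sum_distrib_left)
  finally show ?thesis using Pair by simp
qed

lemma hv_act2_delta: "finite (hsupp t) \<Longrightarrow> hv_act2 (delta b) t = hv_act b t"
  by (rule ext) (simp add: hv_act2_expand)

lemma hv_act_diff: "hv_act b (\<lambda>p. s p - t p) p = hv_act b s p - hv_act b t p"
  by (cases p) (simp add: hv_act_def algebra_simps)

lemma hv_act_add: "hv_act b (\<lambda>p. s p + t p) p = hv_act b s p + hv_act b t p"
  by (cases p) (simp add: hv_act_def algebra_simps)

lemma hv_act_zero [simp]: "hv_act b (\<lambda>p. 0) = (\<lambda>p. 0)"
  by (auto simp: hv_act_def)

lemma hv_act_skew:
  assumes "\<And>c1 c2. t (c2, c1) = - t (c1, c2)"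
  shows "hv_act b t (c2, c1) = - hv_act b t (c1, c2)"
proof -
  have "t (c2, br_pre b c1) = - t (br_pre b c1, c2)" "t (br_pre b c2, c1) = - t (c1, br_pre b c2)"
    by (rule assms)+
  then show ?thesis by (simp add: hv_act_def)
qed

lemma hv_act_L_zero: "hv_act (Lb 0) t (d, e) = (hv_deg d + hv_deg e) * t (d, e)"
  by (cases d; cases e) (auto simp: hv_act_def algebra_simps)

section \<open>Commutation relations of the action\<close>

definition hv_ad :: "'a::field hvb \<Rightarrow> ('a hvb \<Rightarrow> 'a) \<Rightarrow> 'a hvb \<Rightarrow> 'a" where
  "hv_ad b f c = br_coeff b c * f (br_pre b c)"

lemma hv_ad_LL: "hv_ad (Lb x) (hv_ad (Lb z) f) c - hv_ad (Lb z) (hv_ad (Lb x) f) c = (z - x) * hv_ad (Lb (x + z)) f c"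
proof (cases c)
  case (Lb s)
  then show ?thesis by (simp add: hv_ad_def algebra_simps)
next
  case (Ib q)
  then show ?thesis by (simp add: hv_ad_def algebra_simps)
qed

lemma hv_ad_LI:
  "hv_ad (Lb x) (hv_ad (Ib y) f) c - hv_ad (Ib y) (hv_ad (Lb x) f) c = y * hv_ad (Ib (x + y)) f c"
proof (cases c)
  case (Ib q)
  have "q - x - y = q - (x + y)" "q - y - x = q - (x + y)" by simp_all
  then show ?thesis unfolding Ib
    by (simp add: hv_ad_def) (simp add: algebra_simps)
qed (simp add: hv_ad_def)

text \<open>The vanishing commutator is written as a multiple of \<open>hv_ad (Ib 0)\<close> to give
  it the shape expected by \<open>hv_act_commutator\<close>.\<close>

lemma hv_ad_II: "hv_ad (Ib x) (hv_ad (Ib y) f) c - hv_ad (Ib y) (hv_ad (Ib x) f) c = 0 * hv_ad (Ib 0) f c"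
  by (cases c) (auto simp: hv_ad_def)

text \<open>Actions on different tensor factors commute, so the mixed terms cancel and each factor
  contributes its own commutator.\<close>

lemma hv_act_commutator:
  assumes "\<And>f c. hv_ad b (hv_ad b' f) c - hv_ad b' (hv_ad b f) c = k * hv_ad b'' f c"
  shows "hv_act b (hv_act b' t) p - hv_act b' (hv_act b t) p = k * hv_act b'' t p"
proof (cases p)
  case (Pair c d)
  have "hv_act b (hv_act b' t) p - hv_act b' (hv_act b t) p
      = (hv_ad b (hv_ad b' (\<lambda>e. t (e, d))) c - hv_ad b' (hv_ad b (\<lambda>e. t (e, d))) c)
      + (hv_ad b (hv_ad b' (\<lambda>e. t (c, e))) d - hv_ad b' (hv_ad b (\<lambda>e. t (c, e))) d)"
    by (simp add: Pair hv_act_def hv_ad_def algebra_simps)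
  also have "\<dots> = k * hv_act b'' t p"
    unfolding assms by (simp add: Pair hv_act_def hv_ad_def algebra_simps)
  finally show ?thesis .
qed

lemmas hv_act_LL = hv_act_commutator[OF hv_ad_LL]
lemmas hv_act_LI = hv_act_commutator[OF hv_ad_LI]
lemmas hv_act_II = hv_act_commutator[OF hv_ad_II]

lemma hv_act_I_zero [simp]: "hv_act (Ib 0) t = (\<lambda>p. 0)"
proof -
  have "br_coeff (Ib 0) c = 0" for c :: "'a hvb" by (cases c) auto
  then show ?thesis by (auto simp: hv_act_def)
qed

lemma hv_act_graded:
  assumes t: "\<And>c d. hv_deg c + hv_deg d \<noteq> 0 \<Longrightarrow> t (c, d) = 0"
    and "hv_deg c + hv_deg d \<noteq> hv_deg b"
  shows "hv_act b t (c, d) = 0"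
proof -
  have "br_coeff b c * t (br_pre b c, d) = 0" "br_coeff b d * t (c, br_pre b d) = 0"
    using assms(2) by (cases b; cases c; cases d; auto intro!: t simp: algebra_simps)+
  then show ?thesis by (simp only: hv_act_def prod.case add_0)
qed

context int_subgroup
begin

lemma br_closed: "b \<in> hv_basis \<Gamma> \<Longrightarrow> br_pre b c \<in> hv_basis \<Gamma> \<Longrightarrow> br_coeff b c \<noteq> 0 \<Longrightarrow> c \<in> hv_basis \<Gamma>"
  using add_mem[of "hv_deg b" "hv_deg (br_pre b c)"]
  by (cases b; cases c) (auto simp: hv_basis_def split: if_splits)

lemma hv_act_carrier2:
  assumes b: "b \<in> hv_basis \<Gamma>" and t: "t \<in> hv_carrier2 \<Gamma>"
  shows "hv_act b t \<in> hv_carrier2 \<Gamma>"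
proof -
  have sub: "hsupp t \<subseteq> hv_basis \<Gamma> \<times> hv_basis \<Gamma>" and fin: "finite (hsupp t)"
    using t by (auto simp: hv_carrier2_def)
  have *: "(c1, c2) \<in> (\<lambda>(d, e). (br_post b d, e)) ` hsupp t \<union> (\<lambda>(d, e). (d, br_post b e)) ` hsupp t \<and>
      c1 \<in> hv_basis \<Gamma> \<and> c2 \<in> hv_basis \<Gamma>" if "hv_act b t (c1, c2) \<noteq> 0" for c1 c2
  proof -
    from that consider "br_coeff b c1 \<noteq> 0" "t (br_pre b c1, c2) \<noteq> 0"
      | "br_coeff b c2 \<noteq> 0" "t (c1, br_pre b c2) \<noteq> 0"
      by (fastforce simp: hv_act_def)
    then show ?thesis
    proof cases
      case 1
      then have h: "(br_pre b c1, c2) \<in> hsupp t" by (simp add: hsupp_def)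
      then have "(c1, c2) \<in> (\<lambda>(d, e). (br_post b d, e)) ` hsupp t"
        using br_post_pre[OF 1(1)] by (intro image_eqI[OF _ h]) auto
      then show ?thesis using br_closed[OF b _ 1(1)] h sub by auto
    next
      case 2
      then have h: "(c1, br_pre b c2) \<in> hsupp t" by (simp add: hsupp_def)
      then have "(c1, c2) \<in> (\<lambda>(d, e). (d, br_post b e)) ` hsupp t"
        using br_post_pre[OF 2(1)] by (intro image_eqI[OF _ h]) auto
      then show ?thesis using br_closed[OF b _ 2(1)] h sub by auto
    qed
  qed
  have "hsupp (hv_act b t) \<subseteq> (\<lambda>(d, e). (br_post b d, e)) ` hsupp t \<union> (\<lambda>(d, e). (d, br_post b e)) ` hsupp t"
    using * by (auto simp: hsupp_def)
  then have "finite (hsupp (hv_act b t))" using fin finite_subset by blast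
  moreover have "hsupp (hv_act b t) \<subseteq> hv_basis \<Gamma> \<times> hv_basis \<Gamma>"
    using * by (auto simp: hsupp_def)
  ultimately show ?thesis by (simp add: hv_carrier2_def)
qed

lemma carrier2_comb:
  assumes "s \<in> hv_carrier2 \<Gamma>" "t \<in> hv_carrier2 \<Gamma>" "\<And>p. s p = 0 \<Longrightarrow> t p = 0 \<Longrightarrow> u p = 0"
  shows "u \<in> hv_carrier2 \<Gamma>"
proof -
  have "hsupp u \<subseteq> hsupp s \<union> hsupp t" using assms(3) by (auto simp: hsupp_def)
  then show ?thesis using assms(1,2) unfolding hv_carrier2_def
    by (auto intro: finite_subset[of _ "hsupp s \<union> hsupp t"])
qed

lemma almost_all_br_post:
  assumes "finite S"
  shows "\<forall>\<^sub>F z in almost_all. br_post (Lb z) d \<notin> S"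
proof -
  have "inj (\<lambda>z. br_post (Lb z) d)" by (cases d) (auto simp: inj_def)
  then have "finite ((\<lambda>z. br_post (Lb z) d) -` S)" using assms by (rule finite_vimageI[rotated])
  then show ?thesis unfolding eventually_almost_all by (rule rev_finite_subset) auto
qed

lemma almost_all_br_coeff:
  assumes "d \<in> hv_basis \<Gamma>"
  shows "\<forall>\<^sub>F z in almost_all. br_pre (Lb z) (br_post (Lb z) d) = d \<and> br_coeff (Lb z) (br_post (Lb z) d) \<noteq> 0"
  using almost_all_neq[of "hv_deg d"] almost_all_neq[of "- hv_deg d"]
proof eventually_elim
  case (elim z)
  then show ?case using assms
    by (cases d) (auto simp: hv_basis_def eq_neg_iff_add_eq_0 add.commute)
qed

text \<open>For generic \<open>z\<close> the image of \<open>d\<close> under L_z leaves the first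
  projection of the support. At that position only \<open>t (d, e)\<close> contributes to L_z . t,
  with a nonzero factor.\<close>

lemma no_invariants2:
  assumes t: "t \<in> hv_carrier2 \<Gamma>" and inv: "\<And>z. z \<in> \<Gamma> \<Longrightarrow> hv_act (Lb z) t = (\<lambda>p. 0)"
  shows "t = (\<lambda>p. 0)"
proof
  fix p :: "'a hvb \<times> 'a hvb"
  obtain d e where p: "p = (d, e)" by force
  show "t p = 0"
  proof (cases "d \<in> hv_basis \<Gamma>")
    case False
    then show ?thesis using t p by (auto simp: hv_carrier2_def hsupp_def)
  next
    case True
    have fin: "finite (fst ` hsupp t)" using t by (auto simp: hv_carrier2_def)
    have "\<forall>\<^sub>F z in almost_all. t p = 0"
      using almost_all_br_coeff[OF True] almost_all_br_post[OF fin, of d] almost_all_mem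
    proof eventually_elim
      case (elim z)
      have "t (br_post (Lb z) d, c) = 0" for c
        using elim by (force simp: hsupp_def)
      then show ?case
        using fun_cong[OF inv[of z], of "(br_post (Lb z) d, e)"] elim by (simp add: hv_act_def p)
    qed
    then show ?thesis by (simp add: almost_all_const)
  qed
qed

end

section \<open>Skew cocycles and the reduction to degree zero\<close>

text \<open>\<open>A b\<close> is the value of a cocycle at the basis vector \<open>b\<close>. Since
  I_0 = 0, nothing is said about \<open>A (Ib 0)\<close>, which explains the case distinction in
  \<open>LI\<close>.\<close>

locale hv_cocycle = int_subgroup +
  fixes A :: "'a hvb \<Rightarrow> 'a hvb \<times> 'a hvb \<Rightarrow> 'a"
  assumes carrier: "b \<in> hv_basis \<Gamma> \<Longrightarrow> A b \<in> hv_carrier2 \<Gamma>"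
    and skew: "b \<in> hv_basis \<Gamma> \<Longrightarrow> A b (d, c) = - A b (c, d)"
    and LL: "x \<in> \<Gamma> \<Longrightarrow> z \<in> \<Gamma> \<Longrightarrow>
      (z - x) * A (Lb (x + z)) p = hv_act (Lb x) (A (Lb z)) p - hv_act (Lb z) (A (Lb x)) p"
    and LI: "x \<in> \<Gamma> \<Longrightarrow> y \<in> \<Gamma> \<Longrightarrow> y \<noteq> 0 \<Longrightarrow>
      (if x + y = 0 then 0 else y * A (Ib (x + y)) p) = hv_act (Lb x) (A (Ib y)) p - hv_act (Ib y) (A (Lb x)) p"
    and II: "x \<in> \<Gamma> \<Longrightarrow> y \<in> \<Gamma> \<Longrightarrow> x \<noteq> 0 \<Longrightarrow> y \<noteq> 0 \<Longrightarrow>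
      hv_act (Ib x) (A (Ib y)) p - hv_act (Ib y) (A (Ib x)) p = 0"
begin

lemma basis_L [simp]: "x \<in> \<Gamma> \<Longrightarrow> Lb x \<in> hv_basis \<Gamma>"
  and basis_I [simp]: "x \<in> \<Gamma> \<Longrightarrow> x \<noteq> 0 \<Longrightarrow> Ib x \<in> hv_basis \<Gamma>"
  by (auto simp: hv_basis_def)

lemma sub_coboundary:
  assumes r': "r \<in> hv_skew2 \<Gamma>"
  shows "hv_cocycle \<Gamma> (\<lambda>b p. A b p - hv_act b r p)"
proof
  note r = hv_skew2_carrier[OF r'] hv_skew2_swap[OF r']
  show "(\<lambda>p. A b p - hv_act b r p) \<in> hv_carrier2 \<Gamma>" if "b \<in> hv_basis \<Gamma>" for b
    by (rule carrier2_comb[OF carrier[OF that] hv_act_carrier2[OF that r(1)]]) auto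
  show "A b (d, c) - hv_act b r (d, c) = - (A b (c, d) - hv_act b r (c, d))" if "b \<in> hv_basis \<Gamma>" for b c d
    using skew[OF that, of d c] hv_act_skew[of r b d c, OF r(2)] by simp
  show "(z - x) * (A (Lb (x + z)) p - hv_act (Lb (x + z)) r p) =
      hv_act (Lb x) (\<lambda>p. A (Lb z) p - hv_act (Lb z) r p) p - hv_act (Lb z) (\<lambda>p. A (Lb x) p - hv_act (Lb x) r p) p"
    if "x \<in> \<Gamma>" "z \<in> \<Gamma>" for x z p
    using LL[OF that, of p] hv_act_LL[of x z r p, symmetric] by (simp add: hv_act_diff right_diff_distrib)
  show "(if x + y = 0 then 0 else y * (A (Ib (x + y)) p - hv_act (Ib (x + y)) r p)) =
      hv_act (Lb x) (\<lambda>p. A (Ib y) p - hv_act (Ib y) r p) p - hv_act (Ib y) (\<lambda>p. A (Lb x) p - hv_act (Lb x) r p) p"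
    if "x \<in> \<Gamma>" "y \<in> \<Gamma>" "y \<noteq> 0" for x y p
  proof -
    have 1: "hv_act (Lb x) (hv_act (Ib y) r) p - hv_act (Ib y) (hv_act (Lb x) r) p
        = (if x + y = 0 then 0 else y * hv_act (Ib (x + y)) r p)"
      using hv_act_LI[of x y r p] by simp
    have "hv_act (Lb x) (\<lambda>p. A (Ib y) p - hv_act (Ib y) r p) p - hv_act (Ib y) (\<lambda>p. A (Lb x) p - hv_act (Lb x) r p) p
        = (hv_act (Lb x) (A (Ib y)) p - hv_act (Ib y) (A (Lb x)) p)
        - (hv_act (Lb x) (hv_act (Ib y) r) p - hv_act (Ib y) (hv_act (Lb x) r) p)"
      by (simp add: hv_act_diff)
    also have "\<dots> = (if x + y = 0 then 0 else y * (A (Ib (x + y)) p - hv_act (Ib (x + y)) r p))"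
      unfolding 1 LI[OF that, symmetric] by (simp add: right_diff_distrib)
    finally show ?thesis by (rule sym)
  qed
  show "hv_act (Ib x) (\<lambda>p. A (Ib y) p - hv_act (Ib y) r p) p - hv_act (Ib y) (\<lambda>p. A (Ib x) p - hv_act (Ib x) r p) p = 0"
    if "x \<in> \<Gamma>" "y \<in> \<Gamma>" "x \<noteq> 0" "y \<noteq> 0" for x y p
    using II[OF that, of p] hv_act_II[of x y r p] by (simp add: hv_act_diff)
qed

text \<open>L_0 acts on tensors as the degree, so all components of \<Delta>(L_0) of nonzero degree
  are L_0 . r for some r. The degree-zero rest \<open>v\<close> is then shown to be invariant, hence
  zero, and the cocycle condition with L_0 becomes homogeneity of the remaining values.\<close>

lemma sub_coboundary_graded:
  obtains r where "r \<in> hv_skew2 \<Gamma>"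
    "\<And>p. A (Lb 0) p = hv_act (Lb 0) r p"
    "\<And>b c d. b \<in> hv_basis \<Gamma> \<Longrightarrow> hv_deg c + hv_deg d \<noteq> hv_deg b \<Longrightarrow> A b (c, d) = hv_act b r (c, d)"
proof -
  \<comment> \<open>In degree zero the division yields 0, so \<open>r\<close> has no component
    there.\<close>
  define r where "r = (\<lambda>(c, d). A (Lb 0) (c, d) / (hv_deg c + hv_deg d))"
  have r1: "r \<in> hv_carrier2 \<Gamma>"
    by (rule carrier2_comb[OF carrier carrier, of "Lb 0" "Lb 0"]) (auto simp: r_def)
  have r2: "r (d, c) = - r (c, d)" for c d
    using skew[of "Lb 0" d c] by (simp add: r_def add.commute)
  interpret B: hv_cocycle \<Gamma> "\<lambda>b p. A b p - hv_act b r p"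
    by (rule sub_coboundary[OF hv_skew2I[OF r1 r2]])
  define v where "v = (\<lambda>p. A (Lb 0) p - hv_act (Lb 0) r p)"
  have v: "v \<in> hv_carrier2 \<Gamma>" using B.carrier[of "Lb 0"] by (simp add: v_def)
  have vdeg: "v (c, d) = 0" if "hv_deg c + hv_deg d \<noteq> 0" for c d
    using that by (simp add: v_def hv_act_L_zero r_def)
  have act_deg: "hv_act b v (c, d) = 0" if "hv_deg c + hv_deg d \<noteq> hv_deg b" for b c d
    using that by (intro hv_act_graded) (auto intro: vdeg)
  have L: "hv_deg b * (A b p - hv_act b r p) = hv_act (Lb 0) (\<lambda>p. A b p - hv_act b r p) p - hv_act b v p"
    if "b \<in> hv_basis \<Gamma>" for b p
  proof (cases b)
    case (Lb x)
    then show ?thesis using B.LL[of 0 x p] that by (auto simp: v_def hv_basis_def)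
  next
    case (Ib x)
    then show ?thesis using B.LI[of 0 x p] that by (auto simp: v_def hv_basis_def)
  qed
  \<comment> \<open>In degree \<open>hv_deg b\<close> the two terms of \<open>L\<close> containing
    the reduced cocycle cancel, leaving b . v; in other degrees b . v vanishes because
    \<open>v\<close> has degree zero.\<close>
  have "hv_act b v (c, d) = 0" if "b \<in> hv_basis \<Gamma>" for b c d
  proof (cases "hv_deg c + hv_deg d = hv_deg b")
    case True
    then show ?thesis using L[OF that, of "(c, d)"] by (simp add: hv_act_L_zero)
  qed (rule act_deg)
  then have act0: "hv_act b v = (\<lambda>p. 0)" if "b \<in> hv_basis \<Gamma>" for b
    using that by auto
  have v0: "v = (\<lambda>p. 0)" by (rule no_invariants2[OF v]) (simp add: act0)
  show ?thesis
  proof (rule that[OF hv_skew2I[OF r1 r2]])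
    show "A (Lb 0) p = hv_act (Lb 0) r p" for p
      using fun_cong[OF v0, of p] by (simp add: v_def)
    show "A b (c, d) = hv_act b r (c, d)" if "b \<in> hv_basis \<Gamma>" "hv_deg c + hv_deg d \<noteq> hv_deg b" for b c d
      using L[OF that(1), of "(c, d)"] that(2) act0[OF that(1)] by (simp add: hv_act_L_zero)
  qed
qed

end

section \<open>Cocycles are coboundaries\<close>

lemma cocycle_arrange:
  fixes C :: "'a::comm_ring_1"
  assumes "C = X1 + X2 - (k1 * Y1 + k2 * Y2)" "k1 = - K1" "k2 = - K2"
  shows "C = X1 + X2 + K1 * Y1 + K2 * Y2"
  using assms by simp

context hv_cocycle
begin

lemma fin_diag:
  assumes b: "b \<in> hv_basis \<Gamma>" and inj: "inj g"
  shows "\<forall>\<^sub>F s in almost_all. A b (g s, h s) = 0"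
proof -
  have "finite (g -` fst ` hsupp (A b))"
    using carrier[OF b] inj by (intro finite_vimageI) (auto simp: hv_carrier2_def)
  moreover have "{s \<in> \<Gamma>. A b (g s, h s) \<noteq> 0} \<subseteq> g -` fst ` hsupp (A b)"
    by (auto simp: hsupp_def image_iff)
  ultimately show ?thesis unfolding eventually_almost_all by (rule rev_finite_subset)
qed

lemma zero_outside:
  assumes "b \<in> hv_basis \<Gamma>" "c \<notin> hv_basis \<Gamma> \<or> d \<notin> hv_basis \<Gamma>"
  shows "A b (c, d) = 0"
  using carrier[OF assms(1)] assms(2) by (auto simp: hv_carrier2_def hsupp_def)

text \<open>By homogeneity the coefficients of the \<Delta>(L_x) are functions of two indices for
  each kind of component, with x recovered as their sum. The I \<otimes> L component follows from
  the L \<otimes> I one by skewness, so three functional equations suffice.\<close>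

lemma L_coboundary:
  assumes L0: "\<And>p. A (Lb 0) p = 0"
    and graded: "\<And>b c d. b \<in> hv_basis \<Gamma> \<Longrightarrow> hv_deg c + hv_deg d \<noteq> hv_deg b \<Longrightarrow> A b (c, d) = 0"
  obtains r where "r \<in> hv_skew2 \<Gamma>"
    "\<And>c d. hv_deg c + hv_deg d \<noteq> 0 \<Longrightarrow> r (c, d) = 0"
    "\<And>x p. x \<in> \<Gamma> \<Longrightarrow> A (Lb x) p = hv_act (Lb x) r p"
proof -
  have eq: "(z - x) * A (Lb (x + z)) (c, d) =
      (br_coeff (Lb x) c * A (Lb z) (br_pre (Lb x) c, d) + br_coeff (Lb x) d * A (Lb z) (c, br_pre (Lb x) d))
    - (br_coeff (Lb z) c * A (Lb x) (br_pre (Lb z) c, d) + br_coeff (Lb z) d * A (Lb x) (c, br_pre (Lb z) d))"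
    if "x \<in> \<Gamma>" "z \<in> \<Gamma>" for x z c d
    using LL[OF that, of "(c, d)"] by (simp add: hv_act_def)
  define a where "a s t = A (Lb (s + t)) (Lb s, Lb t)" for s t
  obtain \<alpha> where \<alpha>_odd: "\<And>s. s \<in> \<Gamma> \<Longrightarrow> \<alpha> (- s) = - \<alpha> s"
    and a_eq: "\<And>s t. s \<in> \<Gamma> \<Longrightarrow> t \<in> \<Gamma> \<Longrightarrow> a s t = (s + 2 * t) * \<alpha> t - (t + 2 * s) * \<alpha> s"
    and \<alpha>_fin: "\<forall>\<^sub>F s in almost_all. \<alpha> s = 0"
  proof (rule LL_cocycle[of a])
    show "a t s = - a s t" if "s \<in> \<Gamma>" "t \<in> \<Gamma>" for s t
      using skew[of "Lb (s + t)" "Lb t" "Lb s"] that by (simp add: a_def add.commute)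
    show "a s (- s) = 0" for s by (simp add: a_def L0)
    show "\<forall>\<^sub>F s in almost_all. a s (x - s) = 0" if "x \<in> \<Gamma>" for x
      using fin_diag[of "Lb x" Lb "\<lambda>s. Lb (x - s)"] that by (simp add: a_def inj_def)
    show "(s + t - 2 * x) * a s t = (s - 2 * x) * a (s - x) t + (t - 2 * x) * a s (t - x)
        + (s + 2 * t - 2 * x) * a (x - t) t + (2 * s + t - 2 * x) * a s (x - s)"
      if "s \<in> \<Gamma>" "t \<in> \<Gamma>" "x \<in> \<Gamma>" for s t x
    proof -
      \<comment> \<open>The cocycle condition for L_x and L_(s+t-x) is read at L_s \<otimes> L_t;
        these identities normalise its indices. The other two components are handled alike.\<close>
      have arg: "s - (s + t - x) = x - t" "t - (s + t - x) = x - s" "x + (s + t - x) = s + t"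
        "s + t - x - x = s + t - 2 * x" "s - x + t = s + t - x" "s + (t - x) = s + t - x"
        "x - t + t = x" "s + (x - s) = x"
        by (simp_all add: algebra_simps)
      show ?thesis unfolding a_def
      proof (rule cocycle_arrange)
        show "(s + t - 2 * x) * A (Lb (s + t)) (Lb s, Lb t) =
            (s - 2 * x) * A (Lb (s - x + t)) (Lb (s - x), Lb t) + (t - 2 * x) * A (Lb (s + (t - x))) (Lb s, Lb (t - x))
          - ((s - 2 * (s + t - x)) * A (Lb (x - t + t)) (Lb (x - t), Lb t)
            + (t - 2 * (s + t - x)) * A (Lb (s + (x - s))) (Lb s, Lb (x - s)))"
          using eq[of x "s + t - x" "Lb s" "Lb t"] that
          by (simp only: br_pre.simps br_coeff.simps diff_mem add_mem arg simp_thms True_implies_equals)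
      qed (simp_all add: algebra_simps)
    qed
  qed blast
  define b where "b s q = A (Lb (s + q)) (Lb s, Ib q)" for s q
  obtain \<rho> where b_eq: "\<And>s q. s \<in> \<Gamma> \<Longrightarrow> q \<in> \<Gamma> \<Longrightarrow> q \<noteq> 0 \<Longrightarrow> b s q = - s * \<rho> (- s) - (s + 2 * q) * \<rho> q"
    and \<rho>_fin: "\<forall>\<^sub>F s in almost_all. \<rho> s = 0"
  proof (rule LI_cocycle[of b])
    show "b s (- s) = 0" for s by (simp add: b_def L0)
    show "\<forall>\<^sub>F s in almost_all. b s (x - s) = 0" if "x \<in> \<Gamma>" for x
      using fin_diag[of "Lb x" Lb "\<lambda>s. Ib (x - s)"] that by (simp add: b_def inj_def)
    show "(s + q - 2 * x) * b s q = (s - 2 * x) * b (s - x) q + (q - x) * b s (q - x)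
        + (s + 2 * q - 2 * x) * b (x - q) q + (s - x) * b s (x - s)"
      if "s \<in> \<Gamma>" "q \<in> \<Gamma>" "x \<in> \<Gamma>" "q \<noteq> 0" for s q x
    proof -
      have arg: "s - (s + q - x) = x - q" "q - (s + q - x) = x - s" "x + (s + q - x) = s + q"
        "s + q - x - x = s + q - 2 * x" "s - x + q = s + q - x" "s + (q - x) = s + q - x"
        "x - q + q = x" "s + (x - s) = x"
        by (simp_all add: algebra_simps)
      show ?thesis unfolding b_def
      proof (rule cocycle_arrange)
        show "(s + q - 2 * x) * A (Lb (s + q)) (Lb s, Ib q) =
            (s - 2 * x) * A (Lb (s - x + q)) (Lb (s - x), Ib q) + (q - x) * A (Lb (s + (q - x))) (Lb s, Ib (q - x))
          - ((s - 2 * (s + q - x)) * A (Lb (x - q + q)) (Lb (x - q), Ib q)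
            + (x - s) * A (Lb (s + (x - s))) (Lb s, Ib (x - s)))"
          using eq[of x "s + q - x" "Lb s" "Ib q"] that
          by (simp only: br_pre.simps br_coeff.simps diff_mem add_mem arg simp_thms True_implies_equals if_False)
      qed (simp_all add: algebra_simps)
    qed
  qed blast
  define c where "c p q = A (Lb (p + q)) (Ib p, Ib q)" for p q
  obtain f where f_even: "\<And>p. p \<in> \<Gamma> \<Longrightarrow> f (- p) = f p"
    and c_eq: "\<And>p q. p \<in> \<Gamma> \<Longrightarrow> q \<in> \<Gamma> \<Longrightarrow> p \<noteq> 0 \<Longrightarrow> q \<noteq> 0 \<Longrightarrow> c p q = f q - f p"
    and f_fin: "\<forall>\<^sub>F p in almost_all. f p = 0"
  proof (rule II_cocycle[of c])
    show "c q p = - c p q" if "p \<in> \<Gamma>" "q \<in> \<Gamma>" for p q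
      using skew[of "Lb (p + q)" "Ib q" "Ib p"] that by (simp add: c_def add.commute)
    show "\<forall>\<^sub>F p in almost_all. c p (x - p) = 0" if "x \<in> \<Gamma>" for x
      using fin_diag[of "Lb x" Ib "\<lambda>p. Ib (x - p)"] that by (simp add: c_def inj_def)
    show "(p + q - 2 * x) * c p q = (p - x) * c (p - x) q + (q - x) * c p (q - x)
        + (q - x) * c (x - q) q + (p - x) * c p (x - p)"
      if "p \<in> \<Gamma>" "q \<in> \<Gamma>" "x \<in> \<Gamma>" "p \<noteq> 0" "q \<noteq> 0" for p q x
    proof -
      have arg: "p - (p + q - x) = x - q" "q - (p + q - x) = x - p" "x + (p + q - x) = p + q"
        "p + q - x - x = p + q - 2 * x"
        "p - x + q = p + q - x" "p + (q - x) = p + q - x" "x - q + q = x" "p + (x - p) = x"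
        by (simp_all add: algebra_simps)
      show ?thesis unfolding c_def
      proof (rule cocycle_arrange)
        show "(p + q - 2 * x) * A (Lb (p + q)) (Ib p, Ib q) =
            (p - x) * A (Lb (p - x + q)) (Ib (p - x), Ib q) + (q - x) * A (Lb (p + (q - x))) (Ib p, Ib (q - x))
          - ((x - q) * A (Lb (x - q + q)) (Ib (x - q), Ib q) + (x - p) * A (Lb (p + (x - p))) (Ib p, Ib (x - p)))"
          using eq[of x "p + q - x" "Ib p" "Ib q"] that
          by (simp only: br_pre.simps br_coeff.simps diff_mem add_mem arg simp_thms True_implies_equals if_False)
      qed (simp_all add: algebra_simps)
    qed
  qed blast
  \<comment> \<open>The quotient \<open>f p / p\<close> is chosen because L_(p+q) sends I_(-q)
    \<otimes> I_q to -q I_p \<otimes> I_q plus a term in the second factor, so the coefficient at -q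
    contributes exactly \<open>f q\<close>. Oddness of \<alpha> and evenness of \<open>f\<close>
    make the tensor skew.\<close>
  define h where "h d e = (case d of Lb s \<Rightarrow> (case e of Lb t \<Rightarrow> \<alpha> s | Ib q \<Rightarrow> \<rho> q)
      | Ib p \<Rightarrow> (case e of Lb t \<Rightarrow> - \<rho> p | Ib q \<Rightarrow> f p / p))" for d e
  define r where "r = (\<lambda>(d, e). if d \<in> hv_basis \<Gamma> \<and> e \<in> hv_basis \<Gamma> \<and> hv_deg d + hv_deg e = 0 then h d e else 0)"
  have r_car: "r \<in> hv_carrier2 \<Gamma>"
  proof -
    let ?X = "(\<lambda>s. (Lb s, Lb (- s))) ` {s \<in> \<Gamma>. \<alpha> s \<noteq> 0} \<union> (\<lambda>q. (Lb (- q), Ib q)) ` {q \<in> \<Gamma>. \<rho> q \<noteq> 0}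
      \<union> (\<lambda>q. (Ib q, Lb (- q))) ` {q \<in> \<Gamma>. \<rho> q \<noteq> 0} \<union> (\<lambda>p. (Ib p, Ib (- p))) ` {p \<in> \<Gamma>. f p \<noteq> 0}"
    have "p \<in> ?X" if "r p \<noteq> 0" for p
    proof -
      obtain d e where p: "p = (d, e)" by force
      have de: "d \<in> hv_basis \<Gamma>" "e \<in> hv_basis \<Gamma>" "hv_deg e = - hv_deg d" "h d e \<noteq> 0"
        using that by (auto simp: p r_def add_eq_0_iff split: if_splits)
      then show ?thesis unfolding p
        by (cases d; cases e) (auto simp: hv_basis_def h_def image_iff)
    qed
    then have "hsupp r \<subseteq> ?X" by (auto simp: hsupp_def)
    moreover have "finite ?X"
      using \<alpha>_fin \<rho>_fin f_fin unfolding eventually_almost_all by simp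
    ultimately have "finite (hsupp r)" by (rule finite_subset)
    then show ?thesis by (auto simp: hv_carrier2_def hsupp_def r_def split: if_splits)
  qed
  have r_skew: "r (e, d) = - r (d, e)" for d e
  proof (cases "d \<in> hv_basis \<Gamma> \<and> e \<in> hv_basis \<Gamma> \<and> hv_deg d + hv_deg e = 0")
    case True
    then have "hv_deg e = - hv_deg d" by (simp add: add_eq_0_iff)
    then show ?thesis using True
      by (cases d; cases e) (auto simp: r_def h_def \<alpha>_odd f_even hv_basis_def)
  next
    case False
    then show ?thesis by (auto simp: r_def add.commute)
  qed
  have r_deg: "r (d, e) = 0" if "hv_deg d + hv_deg e \<noteq> 0" for d e
    using that by (simp add: r_def)
  have r_LL: "r (Lb s, Lb (- s)) = \<alpha> s" if "s \<in> \<Gamma>" for s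
    using that by (simp add: r_def h_def)
  have r_LI: "r (Lb (- q), Ib q) = \<rho> q" "r (Ib q, Lb (- q)) = - \<rho> q" if "q \<in> \<Gamma>" "q \<noteq> 0" for q
    using that by (simp_all add: r_def h_def)
  have r_II: "r (Ib q, Ib (- q)) = f q / q" if "q \<in> \<Gamma>" "q \<noteq> 0" for q
    using that by (simp add: r_def h_def)
  have L_eq: "A (Lb x) (d, e) = hv_act (Lb x) r (d, e)" if x: "x \<in> \<Gamma>" for x d e
  proof (cases "hv_deg d + hv_deg e = x")
    case False
    have "hv_act (Lb x) r (d, e) = 0"
      using False by (intro hv_act_graded) (auto intro: r_deg)
    then show ?thesis using graded[of "Lb x" d e] False x by simp
  next
    case deg: True
    show ?thesis
    proof (cases "d \<in> hv_basis \<Gamma> \<and> e \<in> hv_basis \<Gamma>")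
      case False
      then have "hv_act (Lb x) r (d, e) = 0"
        using hv_act_carrier2[OF basis_L[OF x] r_car] by (auto simp: hv_carrier2_def hsupp_def)
      then show ?thesis using zero_outside[OF basis_L[OF x]] False by auto
    next
      case True
      have LI_eq: "A (Lb (s + q)) (Lb s, Ib q) = hv_act (Lb (s + q)) r (Lb s, Ib q)"
        if "s \<in> \<Gamma>" "q \<in> \<Gamma>" "q \<noteq> 0" for s q
      proof -
        \<comment> \<open>For \<open>s = 0\<close> the index would be I_0, but this term carries the
          factor -s.\<close>
        have "s = 0 \<or> r (Lb s, Ib (- s)) = \<rho> (- s)" using r_LI(1)[of "- s"] that by auto
        then show ?thesis using b_eq[OF that] r_LI(1)[OF that(2,3)] that
          by (auto simp: b_def hv_act_def algebra_simps)
      qed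
      show ?thesis
      proof (cases d)
        case d: (Lb s)
        show ?thesis
        proof (cases e)
          case e: (Lb t)
          have st: "s \<in> \<Gamma>" "t \<in> \<Gamma>" "x = s + t" using True deg by (auto simp: d e hv_basis_def)
          then show ?thesis using a_eq[of s t] r_LL[of s] r_LL[of "- t"] \<alpha>_odd[of t]
            by (simp add: d e a_def hv_act_def algebra_simps)
        next
          case e: (Ib q)
          then show ?thesis using LI_eq[of s q] True deg by (auto simp: d hv_basis_def)
        qed
      next
        case d: (Ib p)
        show ?thesis
        proof (cases e)
          case e: (Lb t)
          then show ?thesis
            using LI_eq[of t p] True deg skew[OF basis_L[OF x], of "Ib p" "Lb t"]
              hv_act_skew[of r "Lb x" "Ib p" "Lb t", OF r_skew]
            by (auto simp: d hv_basis_def add.commute)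
        next
          case e: (Ib q)
          have pq: "p \<in> \<Gamma>" "q \<in> \<Gamma>" "p \<noteq> 0" "q \<noteq> 0" "x = p + q"
            using True deg by (auto simp: d e hv_basis_def)
          then show ?thesis using c_eq[of p q] r_II[of p] r_II[of "- q"] f_even[of q]
            by (simp add: d e c_def hv_act_def algebra_simps)
        qed
      qed
    qed
  qed
  show ?thesis
  proof (rule that[OF hv_skew2I[OF r_car r_skew] r_deg])
    show "A (Lb x) p = hv_act (Lb x) r p" if "x \<in> \<Gamma>" for x p
      using L_eq[OF that] by (cases p) simp
  qed
qed

text \<open>Once \<Delta> vanishes on the L_x, the condition \<open>LI\<close> says that \<Delta> on
  the I_y commutes with the action of the L_x; this settles the L \<otimes> I and I \<otimes> I
  components. The L \<otimes> L component is settled by the condition \<open>II\<close>, read at I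
  \<otimes> L and L \<otimes> I.\<close>

lemma I_zero:
  assumes L0: "\<And>x p. x \<in> \<Gamma> \<Longrightarrow> A (Lb x) p = 0"
    and graded: "\<And>b c d. b \<in> hv_basis \<Gamma> \<Longrightarrow> hv_deg c + hv_deg d \<noteq> hv_deg b \<Longrightarrow> A b (c, d) = 0"
    and y: "y \<in> \<Gamma>" "y \<noteq> 0"
  shows "A (Ib y) p = 0"
proof -
  have A_L: "A (Lb x) = (\<lambda>p. 0)" if "x \<in> \<Gamma>" for x
    using L0[OF that] by auto
  have eq: "(if x + y = 0 then 0 else y * A (Ib (x + y)) (c, d)) =
      br_coeff (Lb x) c * A (Ib y) (br_pre (Lb x) c, d) + br_coeff (Lb x) d * A (Ib y) (c, br_pre (Lb x) d)"
    if "x \<in> \<Gamma>" "y \<in> \<Gamma>" "y \<noteq> 0" for x y c d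
    using LI[OF that, of "(c, d)"] A_L[OF that(1)] by (simp add: hv_act_def[of "Lb x"])
  have eqI: "br_coeff (Ib x) c * A (Ib y) (br_pre (Ib x) c, d) + br_coeff (Ib x) d * A (Ib y) (c, br_pre (Ib x) d)
    = br_coeff (Ib y) c * A (Ib x) (br_pre (Ib y) c, d) + br_coeff (Ib y) d * A (Ib x) (c, br_pre (Ib y) d)"
    if "x \<in> \<Gamma>" "y \<in> \<Gamma>" "x \<noteq> 0" "y \<noteq> 0" for x y c d
    using II[OF that, of "(c, d)"] by (simp add: hv_act_def)
  define e where "e s t = A (Ib (s + t)) (Lb s, Lb t)" for s t
  have e0: "e s t = 0" if "s \<in> \<Gamma>" "t \<in> \<Gamma>" "s + t \<noteq> 0" for s t
  proof (rule hom_LL[OF _ _ _ that])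
    show "\<forall>\<^sub>F s in almost_all. e s (x - s) = 0" if "x \<in> \<Gamma>" "x \<noteq> 0" for x
      using fin_diag[of "Ib x" Lb "\<lambda>s. Lb (x - s)"] that by (simp add: e_def inj_def)
    show "(s' + t) * e s t = (s + t) * e s' t"
      if "s \<in> \<Gamma>" "s' \<in> \<Gamma>" "t \<in> \<Gamma>" "s + t \<noteq> 0" "s' + t \<noteq> 0" "s + s' + t \<noteq> 0" for s s' t
    proof -
      have "s + s' + t - (s' + t) = s" "s + s' + t - (s + t) = s'" by simp_all
      then show ?thesis using eqI[of "s' + t" "s + t" "Ib (s + s' + t)" "Lb t"] that
        by (simp add: e_def del: minus_add_distrib)
    qed
    show "(s + t') * e s t = (s + t) * e s t'"
      if "s \<in> \<Gamma>" "t \<in> \<Gamma>" "t' \<in> \<Gamma>" "s + t \<noteq> 0" "s + t' \<noteq> 0" "s + t + t' \<noteq> 0" for s t t'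
    proof -
      have "s + t + t' - (s + t') = t" "s + t + t' - (s + t) = t'" by simp_all
      then show ?thesis using eqI[of "s + t'" "s + t" "Lb s" "Ib (s + t + t')"] that
        by (simp add: e_def del: minus_add_distrib)
    qed
  qed
  \<comment> \<open>In total degree zero the coefficient would come from the unconstrained
    \<open>A (Ib 0)\<close>. The default 0 makes the equation hold there too, matching I_0 =
    0.\<close>
  define G where "G u q = (if u + q = 0 then 0 else A (Ib (u + q)) (Lb u, Ib q))" for u q
  have G0: "G u q = 0" if "u \<in> \<Gamma>" "q \<in> \<Gamma>" "q \<noteq> 0" for u q
  proof (rule hom_LI[OF _ _ that])
    show "\<forall>\<^sub>F s in almost_all. G s (x - s) = 0" if "x \<in> \<Gamma>" "x \<noteq> 0" for x
      using fin_diag[of "Ib x" Lb "\<lambda>s. Ib (x - s)"] that by (simp add: G_def inj_def)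
    show "(u + q - x) * G u q = (u - 2 * x) * G (u - x) q + (q - x) * G u (q - x)"
      if "u \<in> \<Gamma>" "q \<in> \<Gamma>" "x \<in> \<Gamma>" "q \<noteq> 0" "x \<noteq> u + q" for u q x
    proof -
      have "x + (u + q - x) = u + q" "u - x + q = u + q - x" "u + (q - x) = u + q - x" by simp_all
      then show ?thesis using eq[of x "u + q - x" "Lb u" "Ib q"] that
        unfolding G_def by (simp only: br_pre.simps br_coeff.simps) auto
    qed
  qed
  define k where "k u q = (if u + q = 0 then 0 else A (Ib (u + q)) (Ib u, Ib q))" for u q
  have k0: "k u q = 0" if "u \<in> \<Gamma>" "q \<in> \<Gamma>" "u \<noteq> 0" "q \<noteq> 0" for u q
  proof (rule hom_II[OF _ _ that])
    show "\<forall>\<^sub>F s in almost_all. k s (x - s) = 0" if "x \<in> \<Gamma>" "x \<noteq> 0" for x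
      using fin_diag[of "Ib x" Ib "\<lambda>s. Ib (x - s)"] that by (simp add: k_def inj_def)
    show "(u + q - x) * k u q = (u - x) * k (u - x) q + (q - x) * k u (q - x)"
      if "u \<in> \<Gamma>" "q \<in> \<Gamma>" "x \<in> \<Gamma>" "u \<noteq> 0" "q \<noteq> 0" "x \<noteq> u + q" for u q x
    proof -
      have "x + (u + q - x) = u + q" "u - x + q = u + q - x" "u + (q - x) = u + q - x" by simp_all
      then show ?thesis using eq[of x "u + q - x" "Ib u" "Ib q"] that
        unfolding k_def by (simp only: br_pre.simps br_coeff.simps) auto
    qed
  qed
  obtain c d where p: "p = (c, d)" by force
  have yb: "Ib y \<in> hv_basis \<Gamma>" using y by simp
  show ?thesis
  proof (cases "c \<in> hv_basis \<Gamma> \<and> d \<in> hv_basis \<Gamma> \<and> hv_deg c + hv_deg d = y")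
    case False
    then show ?thesis using zero_outside[OF yb] graded[OF yb] by (auto simp: p)
  next
    case True
    then have deg: "y = hv_deg c + hv_deg d" by simp
    show ?thesis
    proof (cases c)
      case c: (Lb s)
      show ?thesis
      proof (cases d)
        case d: (Lb t)
        then show ?thesis using e0[of s t] True y by (auto simp: p c deg e_def hv_basis_def)
      next
        case d: (Ib q)
        then show ?thesis using G0[of s q] True y by (auto simp: p c deg G_def hv_basis_def)
      qed
    next
      case c: (Ib u)
      show ?thesis
      proof (cases d)
        case d: (Lb t)
        have "A (Ib y) (Lb t, Ib u) = 0"
          using G0[of t u] True y by (auto simp: c d deg G_def hv_basis_def add.commute)
        then show ?thesis using skew[OF yb, of "Ib u" "Lb t"] by (simp add: p c d)
      next
        case d: (Ib q)
        then show ?thesis using k0[of u q] True y by (auto simp: p c deg k_def hv_basis_def)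
      qed
    qed
  qed
qed

text \<open>Three subtractions of knowledge: \<open>r\<close> removes everything not homogeneous,
  \<open>r'\<close> of degree zero removes the values on the L_x while preserving homogeneity, and
  \<open>I_zero\<close> shows that nothing is left.\<close>

lemma coboundary:
  obtains r where "r \<in> hv_skew2 \<Gamma>"
    "\<And>b p. b \<in> hv_basis \<Gamma> \<Longrightarrow> A b p = hv_act b r p"
proof -
  obtain r where r: "r \<in> hv_skew2 \<Gamma>"
    and r0: "\<And>p. A (Lb 0) p = hv_act (Lb 0) r p"
    and r_graded: "\<And>b c d. b \<in> hv_basis \<Gamma> \<Longrightarrow> hv_deg c + hv_deg d \<noteq> hv_deg b \<Longrightarrow> A b (c, d) = hv_act b r (c, d)"
    using sub_coboundary_graded by blast
  interpret B: hv_cocycle \<Gamma> "\<lambda>b p. A b p - hv_act b r p"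
    by (rule sub_coboundary[OF r])
  have B0: "A (Lb 0) p - hv_act (Lb 0) r p = 0" for p by (simp add: r0)
  have B_graded: "A b (c, d) - hv_act b r (c, d) = 0"
    if "b \<in> hv_basis \<Gamma>" "hv_deg c + hv_deg d \<noteq> hv_deg b" for b c d
    using r_graded[OF that] by simp
  obtain r' where r': "r' \<in> hv_skew2 \<Gamma>"
    and r'_deg: "\<And>c d. hv_deg c + hv_deg d \<noteq> 0 \<Longrightarrow> r' (c, d) = 0"
    and r'_L: "\<And>x p. x \<in> \<Gamma> \<Longrightarrow> A (Lb x) p - hv_act (Lb x) r p = hv_act (Lb x) r' p"
    using B.L_coboundary[OF B0 B_graded] by blast
  interpret C: hv_cocycle \<Gamma> "\<lambda>b p. (A b p - hv_act b r p) - hv_act b r' p"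
    by (rule B.sub_coboundary[OF r'])
  have act_deg: "hv_act b r' (c, d) = 0" if "hv_deg c + hv_deg d \<noteq> hv_deg b" for b c d
    using that by (intro hv_act_graded) (auto intro: r'_deg)
  have I: "(A (Ib y) p - hv_act (Ib y) r p) - hv_act (Ib y) r' p = 0" if "y \<in> \<Gamma>" "y \<noteq> 0" for y p
    by (rule C.I_zero) (use that r'_L r_graded act_deg in auto)
  show ?thesis
  proof (rule that[of "\<lambda>p. r p + r' p"])
    show "(\<lambda>p. r p + r' p) \<in> hv_skew2 \<Gamma>"
    proof (rule hv_skew2I)
      show "(\<lambda>p. r p + r' p) \<in> hv_carrier2 \<Gamma>"
        by (rule carrier2_comb[OF hv_skew2_carrier[OF r] hv_skew2_carrier[OF r']]) simp
      show "r (d, c) + r' (d, c) = - (r (c, d) + r' (c, d))" for c d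
        using hv_skew2_swap[OF r, of d c] hv_skew2_swap[OF r', of d c] by simp
    qed
    show "A b p = hv_act b (\<lambda>p. r p + r' p) p" if b: "b \<in> hv_basis \<Gamma>" for b p
    proof (cases b)
      case (Lb x)
      then show ?thesis using r'_L[of x p] b by (auto simp: hv_act_add hv_basis_def algebra_simps)
    next
      case (Ib y)
      then show ?thesis using I[of y p] b by (auto simp: hv_act_add hv_basis_def algebra_simps)
    qed
  qed
qed

end

section \<open>The classical Yang-Baxter equation\<close>

text \<open>The bracket of \<open>u\<close> and \<open>v\<close> as a sum over a fixed finite index set containing the support of \<open>u\<close>;
  this makes bilinearity unconditional.\<close>

definition br_on :: "'a::field hvb set \<Rightarrow> ('a hvb \<Rightarrow> 'a) \<Rightarrow> ('a hvb \<Rightarrow> 'a) \<Rightarrow> 'a hvb \<Rightarrow> 'a" where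
  "br_on S u v c = (\<Sum>b\<in>S. u b * hv_ad b v c)"

lemma br_on_double:
  assumes "finite S" "hsupp v \<subseteq> S"
  shows "br_on S u v c = (\<Sum>p\<in>S. \<Sum>q\<in>S. u p * v q * hv_br_basis p q c)"
proof -
  have "hv_ad p v c = (\<Sum>q\<in>S. v q * hv_br_basis p q c)" for p
  proof -
    have "(\<Sum>q\<in>S. v q * hv_br_basis p q c) = (\<Sum>q\<in>S. if q = br_pre p c then v q * br_coeff p c else 0)"
      by (rule sum.cong) (auto simp: hv_br_basis_eq)
    also have "\<dots> = hv_ad p v c"
      using assms by (auto simp: hv_ad_def hsupp_def)
    finally show ?thesis by simp
  qed
  then show ?thesis by (simp add: br_on_def sum_distrib_left mult.assoc)
qed

lemma hv_br_basis_antisym: "hv_br_basis p q c = - hv_br_basis q p c"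
  by (cases p; cases q) (auto simp: algebra_simps)

lemma br_on_antisym:
  assumes "finite S" "hsupp u \<subseteq> S" "hsupp v \<subseteq> S"
  shows "br_on S u v c = - br_on S v u c"
proof -
  have "br_on S u v c = (\<Sum>q\<in>S. \<Sum>p\<in>S. u p * v q * hv_br_basis p q c)"
    unfolding br_on_double[OF assms(1,3)] by (rule sum.swap)
  also have "\<dots> = (\<Sum>q\<in>S. \<Sum>p\<in>S. - (v q * u p * hv_br_basis q p c))"
    by (intro sum.cong refl) (subst hv_br_basis_antisym, simp)
  also have "\<dots> = - br_on S v u c"
    unfolding br_on_double[OF assms(1,2)] by (simp add: sum_negf)
  finally show ?thesis .
qed

text \<open>The Jacobi identity, with [L_n, q] written as a multiple of the basis vector
  \<open>br_post (Lb n) q\<close>.\<close>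

lemma hv_ad_L_hv_ad:
  "hv_ad (Lb n) (hv_ad q v) c = hv_ad q (hv_ad (Lb n) v) c
    + br_coeff (Lb n) (br_post (Lb n) q) * hv_ad (br_post (Lb n) q) v c"
proof (cases q)
  case (Lb z)
  then show ?thesis using hv_ad_LL[of n z v c] by (simp add: add.commute algebra_simps)
next
  case (Ib y)
  have "y * hv_ad (Ib (n + y)) v c = br_coeff (Lb n) (Ib (n + y)) * hv_ad (Ib (n + y)) v c"
    by (cases c) (auto simp: hv_ad_def add_eq_0_iff)
  then show ?thesis using hv_ad_LI[of n y v c] Ib by (simp add: add.commute diff_eq_eq)
qed

lemma br_L_inverse [simp]:
  "br_pre (Lb n) (br_post (Lb n) c) = c" "br_post (Lb n) (br_pre (Lb n) c) = c"
  by (cases c; simp)+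

text \<open>L_n acts on the bracket as a derivation. The index set has to contain the support of
  \<open>u\<close> and its translate, since the term with [L_n, q] is summed over the translated
  indices.\<close>

lemma hv_ad_L_br_on:
  assumes S: "finite S" and u: "hsupp u \<subseteq> S" "br_post (Lb n) ` hsupp u \<subseteq> S"
  shows "hv_ad (Lb n) (br_on S u v) c = br_on S (hv_ad (Lb n) u) v c + br_on S u (hv_ad (Lb n) v) c"
proof -
  let ?x = "Lb n"
  have fin: "finite (hsupp u)" using S u finite_subset by blast
  have restrict: "(\<Sum>q\<in>S. u q * F q) = (\<Sum>q\<in>hsupp u. u q * F q)" for F
    using S u(1) by (intro sum.mono_neutral_right) (auto simp: hsupp_def)
  have "hv_ad ?x (br_on S u v) c = (\<Sum>q\<in>S. u q * hv_ad ?x (hv_ad q v) c)"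
    by (simp add: hv_ad_def[of ?x] br_on_def sum_distrib_left algebra_simps)
  also have "\<dots> = br_on S u (hv_ad ?x v) c
      + (\<Sum>q\<in>S. u q * (br_coeff ?x (br_post ?x q) * hv_ad (br_post ?x q) v c))"
    unfolding hv_ad_L_hv_ad br_on_def by (simp add: distrib_left sum.distrib)
  also have "(\<Sum>q\<in>S. u q * (br_coeff ?x (br_post ?x q) * hv_ad (br_post ?x q) v c))
      = (\<Sum>q\<in>hsupp u. u q * (br_coeff ?x (br_post ?x q) * hv_ad (br_post ?x q) v c))"
    by (rule restrict)
  also have "\<dots> = (\<Sum>q'\<in>br_post ?x ` hsupp u. hv_ad ?x u q' * hv_ad q' v c)"
  proof (subst sum.reindex)
    show "inj_on (br_post ?x) (hsupp u)" by (rule inj_on_inverseI[of _ "br_pre ?x"]) simp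
  qed (simp add: hv_ad_def[of ?x u] mult_ac)
  also have "\<dots> = br_on S (hv_ad ?x u) v c"
    unfolding br_on_def
  proof (rule sum.mono_neutral_left[OF S u(2)])
    show "\<forall>q'\<in>S - br_post ?x ` hsupp u. hv_ad ?x u q' * hv_ad q' v c = 0"
    proof
      fix q' assume "q' \<in> S - br_post ?x ` hsupp u"
      then have "br_pre ?x q' \<notin> hsupp u"
        by (metis DiffD2 br_L_inverse(2) image_eqI)
      then show "hv_ad ?x u q' * hv_ad q' v c = 0" by (simp add: hv_ad_def[of ?x u] hsupp_def)
    qed
  qed
  finally show ?thesis by (simp add: add.commute)
qed

lemma sum_delta_snd:
  assumes "finite (hsupp r)" "finite S" "fst ` hsupp r \<subseteq> S"
  shows "(\<Sum>i\<in>hsupp r. r i * delta (snd i) c * F (fst i)) = (\<Sum>p\<in>S. r (p, c) * (F p :: 'a::field))"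
proof -
  have "(\<Sum>i\<in>hsupp r. r i * delta (snd i) c * F (fst i)) = (\<Sum>i\<in>{i \<in> hsupp r. snd i = c}. r i * F (fst i))"
    using assms(1) by (intro sum.mono_neutral_cong_right) (auto simp: delta_def)
  also have "\<dots> = (\<Sum>p\<in>fst ` {i \<in> hsupp r. snd i = c}. r (p, c) * F p)"
    by (subst sum.reindex) (auto simp: inj_on_def intro!: sum.cong)
  also have "\<dots> = (\<Sum>p\<in>S. r (p, c) * F p)"
    using assms by (intro sum.mono_neutral_left) (force simp: hsupp_def)+
  finally show ?thesis .
qed

lemma sum_delta_fst:
  assumes "finite (hsupp r)" "finite S" "snd ` hsupp r \<subseteq> S"
  shows "(\<Sum>i\<in>hsupp r. r i * delta (fst i) c * F (snd i)) = (\<Sum>q\<in>S. r (c, q) * (F q :: 'a::field))"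
proof -
  have "(\<Sum>i\<in>hsupp r. r i * delta (fst i) c * F (snd i)) = (\<Sum>i\<in>{i \<in> hsupp r. fst i = c}. r i * F (snd i))"
    using assms(1) by (intro sum.mono_neutral_cong_right) (auto simp: delta_def)
  also have "\<dots> = (\<Sum>q\<in>snd ` {i \<in> hsupp r. fst i = c}. r (c, q) * F q)"
    by (subst sum.reindex) (auto simp: inj_on_def intro!: sum.cong)
  also have "\<dots> = (\<Sum>q\<in>S. r (c, q) * F q)"
    using assms by (intro sum.mono_neutral_left) (force simp: hsupp_def)+
  finally show ?thesis .
qed

text \<open>For skew \<open>r\<close> the columns \<open>\<lambda>p. r (p, c)\<close> turn the classical Yang-Baxter expression into a cyclic sum.\<close>

lemma hv_cyb_columns:
  assumes r: "r \<in> hv_skew2 \<Gamma>" and S: "finite S" "fst ` hsupp r \<subseteq> S"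
  shows "hv_cyb r (c1, c2, c3) = br_on S (\<lambda>p. r (p, c2)) (\<lambda>p. r (p, c3)) c1
    + br_on S (\<lambda>p. r (p, c3)) (\<lambda>p. r (p, c1)) c2 + br_on S (\<lambda>p. r (p, c1)) (\<lambda>p. r (p, c2)) c3"
proof -
  have fin: "finite (hsupp r)" using hv_skew2_carrier[OF r] by (simp add: hv_carrier2_def)
  have sw: "r (c, d) = - r (d, c)" for c d by (rule hv_skew2_swap[OF r])
  have S': "snd ` hsupp r \<subseteq> S"
  proof
    fix q assume "q \<in> snd ` hsupp r"
    then obtain p where "r (p, q) \<noteq> 0" by (auto simp: hsupp_def)
    then have "(q, p) \<in> hsupp r" using sw[of q p] by (simp add: hsupp_def)
    then show "q \<in> S" using S(2) by (auto simp: image_subset_iff)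
  qed
  have col: "hsupp (\<lambda>p. r (p, c)) \<subseteq> S" for c
    using S(2) by (force simp: hsupp_def)
  note snds = sum_delta_snd[OF fin S]
    and fsts = sum_delta_fst[OF fin S(1) S']
  have 1: "(\<Sum>i\<in>hsupp r. \<Sum>j\<in>hsupp r. r i * r j * (hv_br_basis (fst i) (fst j) c1 * delta (snd i) c2 * delta (snd j) c3))
      = br_on S (\<lambda>p. r (p, c2)) (\<lambda>p. r (p, c3)) c1"
  proof -
    have "(\<Sum>i\<in>hsupp r. \<Sum>j\<in>hsupp r. r i * r j * (hv_br_basis (fst i) (fst j) c1 * delta (snd i) c2 * delta (snd j) c3))
      = (\<Sum>i\<in>hsupp r. r i * delta (snd i) c2 * (\<Sum>j\<in>hsupp r. r j * delta (snd j) c3 * hv_br_basis (fst i) (fst j) c1))"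
      by (simp add: sum_distrib_left mult_ac)
    also have "\<dots> = (\<Sum>p\<in>S. r (p, c2) * (\<Sum>q\<in>S. r (q, c3) * hv_br_basis p q c1))"
      by (simp only: snds[of c3 "\<lambda>q. hv_br_basis p q c1" for p]
          snds[of c2 "\<lambda>p. \<Sum>q\<in>S. r (q, c3) * hv_br_basis p q c1"])
    also have "\<dots> = br_on S (\<lambda>p. r (p, c2)) (\<lambda>p. r (p, c3)) c1"
      unfolding br_on_double[OF S(1) col] by (simp add: sum_distrib_left mult_ac)
    finally show ?thesis .
  qed
  have 2: "(\<Sum>i\<in>hsupp r. \<Sum>j\<in>hsupp r. r i * r j * (delta (fst i) c1 * hv_br_basis (snd i) (fst j) c2 * delta (snd j) c3))
      = br_on S (\<lambda>p. r (p, c3)) (\<lambda>p. r (p, c1)) c2"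
  proof -
    have "(\<Sum>i\<in>hsupp r. \<Sum>j\<in>hsupp r. r i * r j * (delta (fst i) c1 * hv_br_basis (snd i) (fst j) c2 * delta (snd j) c3))
      = (\<Sum>i\<in>hsupp r. r i * delta (fst i) c1 * (\<Sum>j\<in>hsupp r. r j * delta (snd j) c3 * hv_br_basis (snd i) (fst j) c2))"
      by (simp add: sum_distrib_left mult_ac)
    also have "\<dots> = (\<Sum>q\<in>S. r (c1, q) * (\<Sum>p\<in>S. r (p, c3) * hv_br_basis q p c2))"
      by (simp only: snds[of c3 "\<lambda>p. hv_br_basis q p c2" for q]
          fsts[of c1 "\<lambda>q. \<Sum>p\<in>S. r (p, c3) * hv_br_basis q p c2"])
    \<comment> \<open>Skewness turns the row of \<open>r\<close> at \<open>c1\<close> into minus a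
      column; antisymmetry of the bracket then absorbs the sign.\<close>
    also have "\<dots> = - br_on S (\<lambda>p. r (p, c1)) (\<lambda>p. r (p, c3)) c2"
      unfolding br_on_double[OF S(1) col] sw[of c1] by (simp add: sum_distrib_left sum_negf mult_ac)
    also have "\<dots> = br_on S (\<lambda>p. r (p, c3)) (\<lambda>p. r (p, c1)) c2"
      by (rule br_on_antisym[OF S(1) col col, symmetric])
    finally show ?thesis .
  qed
  have 3: "(\<Sum>i\<in>hsupp r. \<Sum>j\<in>hsupp r. r i * r j * (delta (fst i) c1 * delta (fst j) c2 * hv_br_basis (snd i) (snd j) c3))
      = br_on S (\<lambda>p. r (p, c1)) (\<lambda>p. r (p, c2)) c3"
  proof -
    have "(\<Sum>i\<in>hsupp r. \<Sum>j\<in>hsupp r. r i * r j * (delta (fst i) c1 * delta (fst j) c2 * hv_br_basis (snd i) (snd j) c3))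
      = (\<Sum>i\<in>hsupp r. r i * delta (fst i) c1 * (\<Sum>j\<in>hsupp r. r j * delta (fst j) c2 * hv_br_basis (snd i) (snd j) c3))"
      by (simp add: sum_distrib_left mult_ac)
    also have "\<dots> = (\<Sum>p\<in>S. r (c1, p) * (\<Sum>q\<in>S. r (c2, q) * hv_br_basis p q c3))"
      by (simp only: fsts[of c2 "\<lambda>q. hv_br_basis p q c3" for p]
          fsts[of c1 "\<lambda>p. \<Sum>q\<in>S. r (c2, q) * hv_br_basis p q c3"])
    also have "\<dots> = br_on S (\<lambda>p. r (p, c1)) (\<lambda>p. r (p, c2)) c3"
      unfolding br_on_double[OF S(1) col] sw[of c1] sw[of c2]
      by (simp add: sum_distrib_left sum_negf mult_ac)
    finally show ?thesis .
  qed
  show ?thesis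
    unfolding hv_cyb_def prod.case hv_bracket_delta distrib_left sum.distrib 1 2 3 by simp
qed

lemma br_on_minus_left: "br_on S (\<lambda>p. - u p) v c = - br_on S u v c"
  by (simp add: br_on_def sum_negf)

lemma br_on_comb_left: "br_on S (\<lambda>p. k * u p + u' p) v c = k * br_on S u v c + br_on S u' v c"
  by (simp add: br_on_def sum.distrib sum_distrib_left algebra_simps)

text \<open>\<open>(1 + \<xi> + \<xi>\<^sup>2) (1 \<otimes> \<Delta>) \<Delta>(L\<^sub>n) = L\<^sub>n \<cdot> c(r)\<close> for the coboundary \<open>\<Delta>\<close> of a skew \<open>r\<close>.\<close>

lemma co_jacobi_cyb:
  assumes r: "r \<in> hv_skew2 \<Gamma>"
    and t: "finite (hsupp t)" "\<And>p. t p = hv_act (Lb n) r p"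
    and D: "\<And>q p. q \<in> snd ` hsupp t \<Longrightarrow> D (delta q) p = hv_act q r p"
  defines "w \<equiv> hv_one_tensor D t"
  shows "w (c1, c2, c3) + w (c3, c1, c2) + w (c2, c3, c1)
    = br_coeff (Lb n) c1 * hv_cyb r (br_pre (Lb n) c1, c2, c3)
    + br_coeff (Lb n) c2 * hv_cyb r (c1, br_pre (Lb n) c2, c3)
    + br_coeff (Lb n) c3 * hv_cyb r (c1, c2, br_pre (Lb n) c3)"
proof -
  let ?x = "Lb n" and ?\<rho> = "\<lambda>c p. r (p, c)"
  have fin: "finite (hsupp r)" using hv_skew2_carrier[OF r] by (simp add: hv_carrier2_def)
  have sw: "r (c, d) = - r (d, c)" for c d by (rule hv_skew2_swap[OF r])
  \<comment> \<open>One index set for all brackets below: it contains the supports of the columns of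
    \<open>r\<close>, their translates under L_n, and the second legs of \<open>t\<close>.\<close>
  define S where "S = fst ` hsupp r \<union> br_post ?x ` fst ` hsupp r \<union> snd ` hsupp t"
  have S: "finite S" "fst ` hsupp r \<subseteq> S" "snd ` hsupp t \<subseteq> S"
    using fin t(1) by (auto simp: S_def)
  have col': "hsupp (?\<rho> c) \<subseteq> fst ` hsupp r" for c by (force simp: hsupp_def)
  have col: "hsupp (?\<rho> c) \<subseteq> S" "br_post ?x ` hsupp (?\<rho> c) \<subseteq> S" for c
    using col'[of c] by (auto simp: S_def)
  have acol: "hsupp (hv_ad ?x (?\<rho> c)) \<subseteq> S" for c
  proof
    fix d assume "d \<in> hsupp (hv_ad ?x (?\<rho> c))"
    then have "br_pre ?x d \<in> hsupp (?\<rho> c)" by (auto simp: hsupp_def hv_ad_def)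
    then have "br_post ?x (br_pre ?x d) \<in> S" using col(2) by blast
    then show "d \<in> S" by simp
  qed
  define B where "B u v c = br_on S u v c" for u v c
  have anti: "B u v c = - B v u c" if "hsupp u \<subseteq> S" "hsupp v \<subseteq> S" for u v c
    unfolding B_def by (rule br_on_antisym[OF S(1) that])
  have cyb: "hv_cyb r (c1, c2, c3) = B (?\<rho> c2) (?\<rho> c3) c1 + B (?\<rho> c3) (?\<rho> c1) c2 + B (?\<rho> c1) (?\<rho> c2) c3" for c1 c2 c3
    unfolding B_def by (rule hv_cyb_columns[OF r S(1,2)])
  \<comment> \<open>Antisymmetry puts the column acted on by L_n on the left in both terms, the form
    in which these brackets occur in \<open>w\<close>.\<close>
  have der: "br_coeff ?x c * B (?\<rho> d) (?\<rho> e) (br_pre ?x c)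
      = B (hv_ad ?x (?\<rho> d)) (?\<rho> e) c - B (hv_ad ?x (?\<rho> e)) (?\<rho> d) c" for c d e
    using hv_ad_L_br_on[OF S(1) col[of d], of "?\<rho> e" c] anti[OF col(1)[of d] acol[of e], of c]
    by (simp add: B_def hv_ad_def)
  have w: "w (c1, c2, c3) = br_coeff ?x c1 * (B (?\<rho> (br_pre ?x c1)) (?\<rho> c2) c3 - B (?\<rho> (br_pre ?x c1)) (?\<rho> c3) c2)
      + B (hv_ad ?x (?\<rho> c1)) (?\<rho> c2) c3 - B (hv_ad ?x (?\<rho> c1)) (?\<rho> c3) c2" for c1 c2 c3
  proof -
    have row: "t (c1, q) = - (br_coeff ?x c1 * ?\<rho> (br_pre ?x c1) q + hv_ad ?x (?\<rho> c1) q)" for q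
      using sw[of "br_pre ?x c1" q] sw[of c1 "br_pre ?x q"] by (simp add: t(2) hv_act_def hv_ad_def)
    have act: "hv_act q r (c2, c3) = hv_ad q (?\<rho> c3) c2 - hv_ad q (?\<rho> c2) c3" for q
      using sw[of c2 "br_pre q c3"] by (simp add: hv_act_def hv_ad_def)
    have "w (c1, c2, c3) = (\<Sum>p\<in>hsupp t. t p * delta (fst p) c1 * hv_act (snd p) r (c2, c3))"
      unfolding w_def hv_one_tensor_def prod.case by (intro sum.cong) (auto simp: D)
    also have "\<dots> = (\<Sum>q\<in>S. t (c1, q) * hv_act q r (c2, c3))"
      by (rule sum_delta_fst[OF t(1) S(1,3)])
    also have "\<dots> = B (\<lambda>q. t (c1, q)) (?\<rho> c3) c2 - B (\<lambda>q. t (c1, q)) (?\<rho> c2) c3"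
      by (simp add: act B_def br_on_def right_diff_distrib sum_subtractf)
    finally show ?thesis
      unfolding row B_def br_on_minus_left br_on_comb_left by (simp add: right_diff_distrib)
  qed
  have "br_coeff ?x c1 * hv_cyb r (br_pre ?x c1, c2, c3) + br_coeff ?x c2 * hv_cyb r (c1, br_pre ?x c2, c3)
      + br_coeff ?x c3 * hv_cyb r (c1, c2, br_pre ?x c3)
    = w (c1, c2, c3) + w (c3, c1, c2) + w (c2, c3, c1)"
    unfolding cyb w distrib_left der
      anti[OF col(1)[of c3] col(1)[of "br_pre ?x c1"]] anti[OF col(1)[of c1] col(1)[of "br_pre ?x c2"]]
      anti[OF col(1)[of c2] col(1)[of "br_pre ?x c3"]]
    by (simp add: right_diff_distrib)
  then show ?thesis by simp
qed

section \<open>Vanishing of invariants in the tensor cube\<close>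

context int_subgroup
begin

text \<open>As for tensor squares, a generic L_z moves the first factor out of \<open>F\<close>, so
  that only one term of the invariance equation survives. Finiteness is asked of the first factor,
  the form provided by \<open>hv_cyb_first_support\<close>.\<close>

lemma no_invariants3:
  fixes T :: "'a hvb \<times> 'a hvb \<times> 'a hvb \<Rightarrow> 'a"
  assumes F: "finite F" "F \<subseteq> hv_basis \<Gamma>" and T: "\<And>c d e. T (c, d, e) \<noteq> 0 \<Longrightarrow> c \<in> F"
    and inv: "\<And>n c1 c2 c3. n \<in> \<Gamma> \<Longrightarrow> br_coeff (Lb n) c1 * T (br_pre (Lb n) c1, c2, c3)
      + br_coeff (Lb n) c2 * T (c1, br_pre (Lb n) c2, c3) + br_coeff (Lb n) c3 * T (c1, c2, br_pre (Lb n) c3) = 0"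
  shows "T = (\<lambda>q. 0)"
proof -
  have "T (c, d, e) = 0" for c d e
  proof (cases "c \<in> F")
    case True
    then have c: "c \<in> hv_basis \<Gamma>" using F by blast
    have "\<forall>\<^sub>F z in almost_all. T (c, d, e) = 0"
      using almost_all_br_coeff[OF c] almost_all_br_post[OF F(1), of c] almost_all_mem
    proof eventually_elim
      case (elim z)
      have "T (br_post (Lb z) c, d', e') = 0" for d' e'
        using elim(2) T by blast
      then show ?case using inv[of z "br_post (Lb z) c" d e] elim by simp
    qed
    then show ?thesis by (simp add: almost_all_const)
  next
    case False
    then show ?thesis using T by blast
  qed
  then show ?thesis by auto
qed

lemma hv_cyb_first_support:
  assumes r: "r \<in> hv_carrier2 \<Gamma>"
  obtains F where "finite F" "F \<subseteq> hv_basis \<Gamma>" "\<And>c d e. hv_cyb r (c, d, e) \<noteq> 0 \<Longrightarrow> c \<in> F"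
proof
  have fin: "finite (hsupp r)" and sub: "hsupp r \<subseteq> hv_basis \<Gamma> \<times> hv_basis \<Gamma>"
    using r by (auto simp: hv_carrier2_def)
  let ?F = "(fst ` hsupp r \<union> (\<lambda>(i, j). br_post (fst i) (fst j)) ` (hsupp r \<times> hsupp r)) \<inter> hv_basis \<Gamma>"
  show "finite ?F" using fin by simp
  show "?F \<subseteq> hv_basis \<Gamma>" by simp
  show "c \<in> ?F" if "hv_cyb r (c, d, e) \<noteq> 0" for c d e
  proof (rule ccontr)
    assume c: "c \<notin> ?F"
    have "hv_br_basis (fst i) (fst j) c = 0" if ij: "i \<in> hsupp r" "j \<in> hsupp r" for i j
    proof (rule ccontr)
      assume "hv_br_basis (fst i) (fst j) c \<noteq> 0"
      then have h: "fst j = br_pre (fst i) c" "br_coeff (fst i) c \<noteq> 0"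
        by (auto simp: hv_br_basis_eq split: if_splits)
      have "c \<in> hv_basis \<Gamma>"
        by (rule br_closed[of "fst i"]) (use ij sub h in \<open>auto simp flip: h(1)\<close>)
      moreover have "c = br_post (fst i) (fst j)" using br_post_pre[OF h(2)] h(1) by simp
      ultimately show False using c ij by force
    qed
    moreover have "(delta (fst i) c :: 'a) = 0" if "i \<in> hsupp r" for i
      using that c sub by (force simp: delta_def)
    ultimately have "hv_cyb r (c, d, e) = 0"
      unfolding hv_cyb_def prod.case by (intro sum.neutral ballI) simp
    with that show False by simp
  qed
qed

end

section \<open>From Lie bialgebra structures to cocycles and the Yang-Baxter equation\<close>

theorem theorem3p1:
  fixes \<Gamma> :: "'a::field_char_0 set"
    and D :: "('a hvb \<Rightarrow> 'a) \<Rightarrow> 'a hvb \<times> 'a hvb \<Rightarrow> 'a"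
  assumes "0 \<in> \<Gamma>"
    and "\<And>x y. x \<in> \<Gamma> \<Longrightarrow> y \<in> \<Gamma> \<Longrightarrow> x + y \<in> \<Gamma>"
    and "\<And>x. x \<in> \<Gamma> \<Longrightarrow> - x \<in> \<Gamma>"
    and "\<int> \<subseteq> \<Gamma>"
    and "is_lie_bialgebra \<Gamma> D"
  shows "\<exists>r\<in>hv_im_1_tau \<Gamma>. (\<forall>x\<in>hv_carrier \<Gamma>. D x = hv_act2 x r) \<and> hv_cyb r = (\<lambda>q. 0)"
proof -
  interpret int_subgroup \<Gamma> by unfold_locales (use assms in auto)
  have D_car: "D u \<in> hv_carrier2 \<Gamma>" if "u \<in> hv_carrier \<Gamma>" for u
    using assms(5) that unfolding is_lie_bialgebra_def by blast
  have D_add: "D (\<lambda>b. u b + v b) = (\<lambda>p. D u p + D v p)" if "u \<in> hv_carrier \<Gamma>" "v \<in> hv_carrier \<Gamma>" for u v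
    using assms(5) that unfolding is_lie_bialgebra_def by blast
  have D_scale: "D (\<lambda>b. a * u b) = (\<lambda>p. a * D u p)" if "u \<in> hv_carrier \<Gamma>" for a u
    using assms(5) that unfolding is_lie_bialgebra_def by blast
  have D_im: "D u \<in> hv_im_1_tau \<Gamma>" if "u \<in> hv_carrier \<Gamma>" for u
    using assms(5) that unfolding is_lie_bialgebra_def by blast
  have D_cojac: "hv_one_tensor D (D u) q + hv_xi (hv_one_tensor D (D u)) q + hv_xi (hv_xi (hv_one_tensor D (D u))) q = 0"
    if "u \<in> hv_carrier \<Gamma>" for u q
    using assms(5) that unfolding is_lie_bialgebra_def Let_def by meson
  have D_cocycle: "D (hv_bracket u v) = (\<lambda>p. hv_act2 u (D v) p - hv_act2 v (D u) p)"
    if "u \<in> hv_carrier \<Gamma>" "v \<in> hv_carrier \<Gamma>" for u v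
    using assms(5) that unfolding is_lie_bialgebra_def by blast
  have delta_car: "delta b \<in> hv_carrier \<Gamma>" if "b \<in> hv_basis \<Gamma>" for b
    using that by (simp add: hv_carrier_def)
  have D_zero: "D (\<lambda>c. 0) = (\<lambda>p. 0)"
    using D_scale[of "delta (Lb 0)" 0] delta_car[of "Lb 0"] by (simp add: hv_basis_def)
  have fin_D: "finite (hsupp (D (delta b)))" if "b \<in> hv_basis \<Gamma>" for b
    using D_car[OF delta_car[OF that]] by (simp add: hv_carrier2_def)
  have D_br: "D (hv_br_basis b b') p = hv_act b (D (delta b')) p - hv_act b' (D (delta b)) p"
    if "b \<in> hv_basis \<Gamma>" "b' \<in> hv_basis \<Gamma>" for b b' p
    using fun_cong[OF D_cocycle[OF delta_car[OF that(1)] delta_car[OF that(2)]], of p]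
    by (simp add: hv_act2_delta fin_D that)
  interpret hv_cocycle \<Gamma> "\<lambda>b. D (delta b)"
  proof
    show "D (delta b) \<in> hv_carrier2 \<Gamma>" if "b \<in> hv_basis \<Gamma>" for b
      by (rule D_car[OF delta_car[OF that]])
    show "D (delta b) (d, c) = - D (delta b) (c, d)" if "b \<in> hv_basis \<Gamma>" for b c d
      using D_im[OF delta_car[OF that]] by (auto simp: hv_im_1_tau_def hv_tau_def)
    show "(z - x) * D (delta (Lb (x + z))) p = hv_act (Lb x) (D (delta (Lb z))) p - hv_act (Lb z) (D (delta (Lb x))) p"
      if "x \<in> \<Gamma>" "z \<in> \<Gamma>" for x z p
    proof -
      have "delta (Lb (x + z)) \<in> hv_carrier \<Gamma>"
        using that by (intro delta_car) (simp add: hv_basis_def)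
      then show ?thesis using D_br[of "Lb x" "Lb z" p] that
        by (simp add: D_scale hv_basis_def)
    qed
    show "(if x + y = 0 then 0 else y * D (delta (Ib (x + y))) p)
        = hv_act (Lb x) (D (delta (Ib y))) p - hv_act (Ib y) (D (delta (Lb x))) p"
      if "x \<in> \<Gamma>" "y \<in> \<Gamma>" "y \<noteq> 0" for x y p
    proof (cases "x + y = 0")
      case True
      then have "hv_br_basis (Lb x) (Ib y) = (\<lambda>c. 0)" by simp
      then show ?thesis using D_br[of "Lb x" "Ib y" p] that True by (simp add: D_zero hv_basis_def)
    next
      case False
      then have "delta (Ib (x + y)) \<in> hv_carrier \<Gamma>"
        using that by (intro delta_car) (simp add: hv_basis_def)
      moreover have "hv_br_basis (Lb x) (Ib y) = (\<lambda>c. y * delta (Ib (x + y)) c)" using False by simp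
      ultimately show ?thesis using D_br[of "Lb x" "Ib y" p] that False
        by (simp add: D_scale hv_basis_def)
    qed
    show "hv_act (Ib x) (D (delta (Ib y))) p - hv_act (Ib y) (D (delta (Ib x))) p = 0"
      if "x \<in> \<Gamma>" "y \<in> \<Gamma>" "x \<noteq> 0" "y \<noteq> 0" for x y p
      using D_br[of "Ib x" "Ib y" p] that by (simp add: D_zero hv_basis_def)
  qed
  obtain r where r: "r \<in> hv_skew2 \<Gamma>" and Dr: "\<And>b p. b \<in> hv_basis \<Gamma> \<Longrightarrow> D (delta b) p = hv_act b r p"
    using coboundary by blast
  have r_car: "r \<in> hv_carrier2 \<Gamma>" by (rule hv_skew2_carrier[OF r])
  have fin_r: "finite (hsupp r)" using r_car by (simp add: hv_carrier2_def)
  \<comment> \<open>Additivity of \<open>D\<close> is available on the carrier only, so membership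
    of the partial sums is carried through the induction.\<close>
  have D_sum: "(\<lambda>c. \<Sum>b\<in>S. u b * delta b c) \<in> hv_carrier \<Gamma> \<and>
      D (\<lambda>c. \<Sum>b\<in>S. u b * delta b c) = (\<lambda>p. \<Sum>b\<in>S. u b * D (delta b) p)"
    if "finite S" "S \<subseteq> hv_basis \<Gamma>" for S u
    using that
  proof (induction S)
    case empty
    then show ?case by (simp add: D_zero hv_carrier_def hsupp_def)
  next
    case (insert b S)
    have b: "delta b \<in> hv_carrier \<Gamma>" using insert by (intro delta_car) simp
    have ub: "(\<lambda>c. u b * delta b c) \<in> hv_carrier \<Gamma>"
    proof -
      have "hsupp (\<lambda>c. u b * delta b c) \<subseteq> {b}" by (auto simp: hsupp_def delta_def)
      then show ?thesis using insert by (auto simp: hv_carrier_def intro: finite_subset)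
    qed
    have IH: "(\<lambda>c. \<Sum>b\<in>S. u b * delta b c) \<in> hv_carrier \<Gamma>"
      "D (\<lambda>c. \<Sum>b\<in>S. u b * delta b c) = (\<lambda>p. \<Sum>b\<in>S. u b * D (delta b) p)"
      using insert by auto
    have "(\<lambda>c. u b * delta b c + (\<Sum>b\<in>S. u b * delta b c)) \<in> hv_carrier \<Gamma>"
    proof -
      have "hsupp (\<lambda>c. u b * delta b c + (\<Sum>b\<in>S. u b * delta b c))
          \<subseteq> hsupp (\<lambda>c. u b * delta b c) \<union> hsupp (\<lambda>c. \<Sum>b\<in>S. u b * delta b c)"
        by (auto simp: hsupp_def)
      then show ?thesis using ub IH(1) unfolding hv_carrier_def
        by (blast intro: finite_subset[OF _ finite_UnI])
    qed
    then show ?case using insert D_add[OF ub IH(1)] by (simp add: D_scale[OF b] IH(2))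
  qed
  have D_eq: "D u = hv_act2 u r" if u: "u \<in> hv_carrier \<Gamma>" for u
  proof
    fix p
    have fin: "finite (hsupp u)" and sub: "hsupp u \<subseteq> hv_basis \<Gamma>" using u by (auto simp: hv_carrier_def)
    have "u = (\<lambda>c. \<Sum>b\<in>hsupp u. u b * delta b c)"
    proof
      fix c
      have "(\<Sum>b\<in>hsupp u. u b * delta b c) = (\<Sum>b\<in>hsupp u. if b = c then u b else 0)"
        by (rule sum.cong) (auto simp: delta_def)
      then show "u c = (\<Sum>b\<in>hsupp u. u b * delta b c)" using fin by (auto simp: hsupp_def)
    qed
    then have "D u p = (\<Sum>b\<in>hsupp u. u b * D (delta b) p)"
      using D_sum[OF fin sub, of u] by metis
    also have "\<dots> = hv_act2 u r p"
      unfolding hv_act2_expand[OF fin_r] using sub by (intro sum.cong) (auto simp: Dr)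
    finally show "D u p = hv_act2 u r p" .
  qed
  obtain F where F: "finite F" "F \<subseteq> hv_basis \<Gamma>" "\<And>c d e. hv_cyb r (c, d, e) \<noteq> 0 \<Longrightarrow> c \<in> F"
    using hv_cyb_first_support[OF r_car] by blast
  \<comment> \<open>Co-Jacobi at L_n says that L_n . c(r) = 0, by \<open>co_jacobi_cyb\<close>;
    hence c(r) is an invariant with finite support in its first factor.\<close>
  have "hv_cyb r = (\<lambda>q. 0)"
  proof (rule no_invariants3[OF F])
    fix n c1 c2 c3 assume n: "n \<in> \<Gamma>"
    let ?t = "D (delta (Lb n))"
    have Ln: "Lb n \<in> hv_basis \<Gamma>" using n by simp
    have "q \<in> hv_basis \<Gamma>" if "q \<in> snd ` hsupp ?t" for q
      using that D_car[OF delta_car[OF Ln]] by (auto simp: hv_carrier2_def)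
    then have "br_coeff (Lb n) c1 * hv_cyb r (br_pre (Lb n) c1, c2, c3)
      + br_coeff (Lb n) c2 * hv_cyb r (c1, br_pre (Lb n) c2, c3)
      + br_coeff (Lb n) c3 * hv_cyb r (c1, c2, br_pre (Lb n) c3)
      = hv_one_tensor D ?t (c1, c2, c3) + hv_one_tensor D ?t (c3, c1, c2) + hv_one_tensor D ?t (c2, c3, c1)"
      by (intro co_jacobi_cyb[OF r fin_D[OF Ln], symmetric]) (auto simp: Dr Ln)
    also have "\<dots> = 0"
      using D_cojac[OF delta_car[OF Ln], of "(c1, c2, c3)"] by (simp add: hv_xi_def)
    finally show "br_coeff (Lb n) c1 * hv_cyb r (br_pre (Lb n) c1, c2, c3)
      + br_coeff (Lb n) c2 * hv_cyb r (c1, br_pre (Lb n) c2, c3)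
      + br_coeff (Lb n) c3 * hv_cyb r (c1, c2, br_pre (Lb n) c3) = 0" .
  qed
  moreover have "r \<in> hv_im_1_tau \<Gamma>"
  proof -
    \<comment> \<open>Half of a skew tensor is a preimage of it under 1 - \<tau>.\<close>
    have "(\<lambda>p. r p / 2) \<in> hv_carrier2 \<Gamma>" by (rule carrier2_comb[OF r_car r_car]) simp
    moreover have "r = (\<lambda>p. r p / 2 - hv_tau (\<lambda>p. r p / 2) p)"
    proof
      fix p :: "'a hvb \<times> 'a hvb"
      obtain c d where p: "p = (c, d)" by force
      show "r p = r p / 2 - hv_tau (\<lambda>p. r p / 2) p"
        using hv_skew2_swap[OF r, of d c] by (simp add: p hv_tau_def)
    qed
    ultimately show ?thesis unfolding hv_im_1_tau_def
      by (intro CollectI exI[of _ "\<lambda>p. r p / 2"] conjI)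
  qed
  ultimately show ?thesis using D_eq by blast
qed

end
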